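(* Let $G$ be a finite group and $\rho: G\to\mathrm{GL}_{n_3}(\mathbb{R})$ a totally real representation with each $\rho(g)$ orthogonal. Let $\mathbb{C}^{n_3}\simeq V_1\oplus\cdots\oplus V_s$ be the decomposition into irreducibles, $d_j=\dim V_j$, let $M\in\mathrm{O}_{n_3}(\mathbb{R})$ represent a change of basis to a symmetry-adapted basis, and let $W_\rho\subseteq\mathbb{R}_M$ be the space of tubes $\mathbf{x}\in\mathbb{R}^{1\times1\times n_3}$ such that $\mathrm{diag}(M\mathrm{vec}(\mathbf{x}))$ is block diagonal with diagonal blocks $c_1I_{d_1},\dots,c_sI_{d_s}$ for some scalars $c_1,\dots,c_s$. Consider a quadratic form $f\in\mathbb{R}[x_{1,1},x_{1,2},\dots,x_{m,n_3}]_2$ in $mn_3$ variables and collect the variables in the vector $\xi=\begin{bmatrix}x_{1,1}&x_{1,2}&\cdots&x_{1,n_3}&x_{2,1}&\cdots&x_{m,n_3}\end{bmatrix}^\top$. If $f$ is $M$-SOS and there is a Gram tensor $\mathcal{Q}$ for $f$ with tubes in $W_\rho$, then $f$ is a sum of squares (SOS) and is invariant under the action of $G$ on $\mathbb{R}[x_{1,1},\dots,x_{m,n_3}]$ given by $g\cdot\xi=(I_m\otimes\rho(g))\xi$. The converse holds if each irreducible representation in the decomposition of $\mathbb{R}^{n_3}$ appears with multiplicity at most one; that is, in this case, if $f$ is SOS and invariant under this action, then $f$ is $M$-SOS and has a Gram tensor with tubes in $W_\rho$.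
   Context: $\mathrm{O}_{n_3}(\mathbb{R})$ is the group of real orthogonal $n_3\times n_3$ matrices. A tube is an element $\mathbf{a}\in\mathbb{R}^{1\times1\times n_3}$; $\mathrm{vec}(\mathbf{a})\in\mathbb{R}^{n_3}$ has entries $\mathbf{a}_{1,1,k}$, and $\mathrm{tube}$ is the inverse of $\mathrm{vec}$; $\mathrm{diag}(v)$ is the diagonal matrix with diagonal $v$. The $\star_M$-product of tubes is $\mathbf{a}\star_M\mathbf{b}=\mathrm{tube}(M^{-1}\mathrm{diag}(M\mathrm{vec}(\mathbf{a}))M\mathrm{vec}(\mathbf{b}))$, and $\mathbb{R}_M$ is the resulting ring of tubes; tensors in $\mathbb{R}^{n_1\times n_2\times n_3}$ are viewed as $n_1\times n_2$ matrices of tubes $\mathcal{A}_{i,j,:}$ and $(\mathcal{A}\star_M\mathcal{B})_{i,j,:}=\sum_\ell\mathcal{A}_{i,\ell,:}\star_M\mathcal{B}_{\ell,j,:}$ (extended to arrays of variables). The inner product is $\langle\mathcal{A},\mathcal{B}\rangle=\sum_{i,j,k}\mathcal{A}_{i,j,k}\mathcal{B}_{i,j,k}$. A tensor $\mathcal{A}\in\mathbb{R}^{m\times m\times n_3}$ is symmetric if every frontal slice $\mathcal{A}_{:,:,k}$ is symmetric. $\mathrm{PSD}_M^m$ is the set of symmetric $\mathcal{A}\in\mathbb{R}^{m\times m\times n_3}$ with $\langle\mathcal{Y},\mathcal{A}\star_M\mathcal{Y}\rangle\ge0$ for all $\mathcal{Y}\in\mathbb{R}^{m\times1\times n_3}$.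 Let $\mathcal{X}=\mathrm{fold}_{n_3}(\xi)$ be the $m\times1\times n_3$ array whose $i$-th tube is $\mathrm{tube}((x_{i,1},\dots,x_{i,n_3})^\top)$. The quadratic form $f$ is $M$-SOS if there is $\mathcal{Q}\in\mathrm{PSD}_M^m$ with $f=\langle\mathcal{X},\mathcal{Q}\star_M\mathcal{X}\rangle$; such a $\mathcal{Q}$ is called a Gram tensor for $f$. A polynomial is SOS if it is a finite sum of squares of real polynomials. Invariance of $f$ means $f((I_m\otimes\rho(g))\xi)=f(\xi)$ for all $g\in G$, where $\otimes$ is the Kronecker product. A complex representation $V$ is real if $V=V_0\otimes\mathbb{C}$ for a real representation $V_0$; it is totally real if each irreducible summand $V_i$ in its decomposition into (complex) irreducibles is real. For a real $\rho$ this is applied to the complexification $\mathbb{C}^{n_3}$. Symmetry-adapted basis: for $V=V_1\oplus\cdots\oplus V_s$ decomposed into irreducibles with $\dim V_i=d_i$, an ordered basis formed by concatenating ordered bases $\{v_1^{(i)},\dots,v_{d_i}^{(i)}\}$ of $V_i$, $i=1,\dots,s$, such that for every $\rho$-equivariant linear $T:V\to V$ the matrix of $T$ in this basis has blocks $T_{i,j}:V_i\to V_j$ each equal to $c_{i,j}I$ for a scalar $c_{i,j}$ or to $0$. "$M$ represents a change of basis to a symmetry-adapted basis" means that the columns of $M^{-1}$, in order, are the vectors of the symmetry-adapted basis (so $M\rho(g)M^{-1}$ is block diagonal with blocks of sizes $d_1,\dots,d_s$). *)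

theory Defs
  imports
    "HOL-Analysis.Analysis"
    "HOL-Algebra.Group"
    "HOL-Library.Poly_Mapping"
begin

section \<open>Polynomials\<close>

text \<open>Real polynomials in variables indexed by \<open>'v\<close>, as finitely supported functions from
  monomials (finitely supported exponent functions) to coefficients.\<close>

type_synonym 'v rpoly = "('v \<Rightarrow>\<^sub>0 nat) \<Rightarrow>\<^sub>0 real"

definition Const :: "real \<Rightarrow> 'v rpoly" where
  "Const c = Poly_Mapping.single 0 c"

definition Var :: "'v \<Rightarrow> 'v rpoly" where
  "Var v = Poly_Mapping.single (Poly_Mapping.single v 1) 1"

definition poly_subst :: "('v \<Rightarrow> 'w rpoly) \<Rightarrow> 'v rpoly \<Rightarrow> 'w rpoly" where
  "poly_subst \<sigma> f = (\<Sum>a\<in>Poly_Mapping.keys f. Const (Poly_Mapping.lookup f a) *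
      (\<Prod>v\<in>Poly_Mapping.keys a. \<sigma> v ^ Poly_Mapping.lookup a v))"

definition quadratic_form :: "('v::finite) rpoly \<Rightarrow> bool" where
  "quadratic_form f \<longleftrightarrow> (\<forall>a\<in>Poly_Mapping.keys f. (\<Sum>v\<in>UNIV. Poly_Mapping.lookup a v) = 2)"

definition SOS :: "'v rpoly \<Rightarrow> bool" where
  "SOS f \<longleftrightarrow> (\<exists>ps. f = (\<Sum>p\<leftarrow>ps. p ^ 2))"


section \<open>Tubes and tensors\<close>

text \<open>A tube is identified with the vector of its entries, so that \<open>vec\<close> and \<open>tube\<close> are
  identities. An \<open>n\<^sub>1 \<times> n\<^sub>2 \<times> n\<^sub>3\<close> tensor is an element \<open>A :: 'a^'n3^'n2^'n1\<close> with entries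
  \<open>A $ i $ j $ k\<close> and tubes \<open>A $ i $ j\<close>. The operations are defined over an arbitrary
  commutative ring, so that they also apply to arrays of polynomials; a real matrix or tensor is
  then first mapped entrywise by \<^const>\<open>Const\<close>.\<close>

definition diag :: "('a::zero)^'n \<Rightarrow> 'a^'n^'n" where
  "diag v = (\<chi> i j. if i = j then v $ i else 0)"

definition tube_prod :: "('a::comm_ring_1)^'n^'n \<Rightarrow> 'a^'n \<Rightarrow> 'a^'n \<Rightarrow> 'a^'n" where
  "tube_prod M a b = matrix_inv M *v (diag (M *v a) *v (M *v b))"

definition tensor_prod ::
    "('a::comm_ring_1)^'n^'n \<Rightarrow> 'a^'n^'l^'r \<Rightarrow> 'a^'n^'c^'l \<Rightarrow> 'a^'n^'c^'r" where
  "tensor_prod M A B = (\<chi> i j. \<Sum>l\<in>UNIV. tube_prod M (A $ i $ l) (B $ l $ j))"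

definition tensor_inner :: "('a::comm_ring_1)^'n^'c^'r \<Rightarrow> 'a^'n^'c^'r \<Rightarrow> 'a" where
  "tensor_inner A B = (\<Sum>i\<in>UNIV. \<Sum>j\<in>UNIV. \<Sum>k\<in>UNIV. A $ i $ j $ k * B $ i $ j $ k)"

definition map_tensor :: "('a \<Rightarrow> 'b) \<Rightarrow> 'a^'n^'c^'r \<Rightarrow> 'b^'n^'c^'r" where
  "map_tensor h A = (\<chi> i j k. h (A $ i $ j $ k))"

definition frontal_slice :: "'a^'n^'c^'r \<Rightarrow> 'n \<Rightarrow> 'a^'c^'r" where
  "frontal_slice A k = (\<chi> i j. A $ i $ j $ k)"

definition symmetric_tensor :: "'a^'n^'m^'m \<Rightarrow> bool" where
  "symmetric_tensor A \<longleftrightarrow> (\<forall>k. transpose (frontal_slice A k) = frontal_slice A k)"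

definition PSD :: "real^'n^'n \<Rightarrow> (real^'n^'m^'m) set" where
  "PSD M = {A. symmetric_tensor A \<and>
      (\<forall>Y :: real^'n^1^'m. 0 \<le> tensor_inner Y (tensor_prod M A Y))}"

definition xi :: "(('m \<times> 'n) rpoly)^('m::finite \<times> 'n::finite)" where
  "xi = (\<chi> p. Var p)"

definition fold_tensor :: "'a^('m::finite \<times> 'n::finite) \<Rightarrow> 'a^'n^1^'m" where
  "fold_tensor v = (\<chi> i j k. v $ (i, k))"

definition gram_tensor ::
    "real^'n^'n \<Rightarrow> ('m::finite \<times> 'n::finite) rpoly \<Rightarrow> real^'n^'m^'m \<Rightarrow> bool" where
  "gram_tensor M f Q \<longleftrightarrow> Q \<in> PSD M \<and>
     f = tensor_inner (fold_tensor xi)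
           (tensor_prod (map_matrix Const M) (map_tensor Const Q) (fold_tensor xi))"

definition M_SOS :: "real^'n^'n \<Rightarrow> ('m::finite \<times> 'n::finite) rpoly \<Rightarrow> bool" where
  "M_SOS M f \<longleftrightarrow> (\<exists>Q. gram_tensor M f Q)"


section \<open>Representations\<close>

definition GL :: "(('a::field)^'n^'n) monoid" where
  "GL = \<lparr>carrier = {A. invertible A}, mult = (**), one = mat 1\<rparr>"

definition complexify :: "('g \<Rightarrow> real^'n^'n) \<Rightarrow> 'g \<Rightarrow> complex^'n^'n" where
  "complexify \<rho> g = map_matrix complex_of_real (\<rho> g)"

definition subrep ::
    "('g, 'b) monoid_scheme \<Rightarrow> ('g \<Rightarrow> ('a::field)^'n^'n) \<Rightarrow> ('a^'n) set \<Rightarrow> bool" where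
  "subrep G \<rho> V \<longleftrightarrow> vec.subspace V \<and> (\<forall>g\<in>carrier G. \<forall>v\<in>V. \<rho> g *v v \<in> V)"

definition irreducible_subrep ::
    "('g, 'b) monoid_scheme \<Rightarrow> ('g \<Rightarrow> ('a::field)^'n^'n) \<Rightarrow> ('a^'n) set \<Rightarrow> bool" where
  "irreducible_subrep G \<rho> V \<longleftrightarrow> subrep G \<rho> V \<and> V \<noteq> {0} \<and>
     (\<forall>U. subrep G \<rho> U \<and> U \<subseteq> V \<longrightarrow> U = {0} \<or> U = V)"

text \<open>The second conjunct says that the whole space is the internal direct sum of the
  subspaces in the list.\<close>

definition irrep_decomposition ::
    "('g, 'b) monoid_scheme \<Rightarrow> ('g \<Rightarrow> ('a::field)^'n^'n) \<Rightarrow> ('a^'n) set list \<Rightarrow> bool" where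
  "irrep_decomposition G \<rho> Vs \<longleftrightarrow>
     (\<forall>V\<in>set Vs. irreducible_subrep G \<rho> V) \<and>
     bij_betw (\<lambda>u. \<Sum>i<length Vs. u i) (\<Pi>\<^sub>E i\<in>{..<length Vs}. Vs ! i) UNIV"

text \<open>Every linear map between subspaces extends to the whole space, so it is harmless that
  \<open>T\<close> is defined globally.\<close>

definition isomorphic_subreps ::
    "('g, 'b) monoid_scheme \<Rightarrow> ('g \<Rightarrow> ('a::field)^'n^'n) \<Rightarrow> ('a^'n) set \<Rightarrow> ('a^'n) set \<Rightarrow> bool"
where
  "isomorphic_subreps G \<rho> U V \<longleftrightarrow>
     (\<exists>T. Vector_Spaces.linear (*s) (*s) T \<and> bij_betw T U V \<and>
          (\<forall>g\<in>carrier G. \<forall>u\<in>U. T (\<rho> g *v u) = \<rho> g *v T u))"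

definition multiplicity_in ::
    "('g, 'b) monoid_scheme \<Rightarrow> ('g \<Rightarrow> ('a::field)^'n^'n) \<Rightarrow> ('a^'n) set list \<Rightarrow> ('a^'n) set \<Rightarrow> nat"
where
  "multiplicity_in G \<rho> Us U = card {i. i < length Us \<and> isomorphic_subreps G \<rho> U (Us ! i)}"

text \<open>Up to isomorphism and order, the irreducible summands do not depend on the decomposition
  (Krull-Schmidt), and for representations of finite groups over a field of characteristic zero a
  decomposition exists (Maschke). So here and in \<open>totally_real\<close> below it does not matter
  whether the decomposition is quantified existentially or universally.\<close>

definition multiplicity_free ::
    "('g, 'b) monoid_scheme \<Rightarrow> ('g \<Rightarrow> ('a::field)^'n^'n) \<Rightarrow> bool" where
  "multiplicity_free G \<rho> \<longleftrightarrow>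
     (\<exists>Us. irrep_decomposition G \<rho> Us \<and> (\<forall>U\<in>set Us. multiplicity_in G \<rho> Us U \<le> 1))"

text \<open>\<open>V = V\<^sub>0 \<otimes> \<complex>\<close> for a real representation \<open>V\<^sub>0\<close>. Identifying \<open>V\<^sub>0\<close> with \<open>V\<^sub>0 \<otimes> 1\<close>,
  it is an invariant real subspace of \<open>V\<close> such that every \<open>v\<close> in \<open>V\<close> is \<open>u + \<i> w\<close> for unique
  \<open>u, w\<close> in \<open>V\<^sub>0\<close>. The constant \<open>subspace\<close> refers to real scalars.\<close>

definition real_subrep ::
    "('g, 'b) monoid_scheme \<Rightarrow> ('g \<Rightarrow> complex^'n^'n) \<Rightarrow> (complex^'n) set \<Rightarrow> bool" where
  "real_subrep G \<rho> V \<longleftrightarrow> subrep G \<rho> V \<and>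
     (\<exists>V\<^sub>0. subspace V\<^sub>0 \<and> (\<forall>g\<in>carrier G. \<forall>v\<in>V\<^sub>0. \<rho> g *v v \<in> V\<^sub>0) \<and>
           bij_betw (\<lambda>(u, w). u + \<i> *s w) (V\<^sub>0 \<times> V\<^sub>0) V)"

definition totally_real ::
    "('g, 'b) monoid_scheme \<Rightarrow> ('g \<Rightarrow> complex^'n^'n) \<Rightarrow> bool" where
  "totally_real G \<rho> \<longleftrightarrow>
     (\<exists>Vs. irrep_decomposition G \<rho> Vs \<and> (\<forall>V\<in>set Vs. real_subrep G \<rho> V))"

definition ordered_basis_of :: "(('a::field)^'n) list \<Rightarrow> ('a^'n) set \<Rightarrow> bool" where
  "ordered_basis_of b V \<longleftrightarrow> distinct b \<and> vec.independent (set b) \<and> vec.span (set b) = V"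

definition equivariant ::
    "('g, 'b) monoid_scheme \<Rightarrow> ('g \<Rightarrow> ('a::field)^'n^'n) \<Rightarrow> ('a^'n \<Rightarrow> 'a^'n) \<Rightarrow> bool" where
  "equivariant G \<rho> T \<longleftrightarrow> Vector_Spaces.linear (*s) (*s) T \<and>
     (\<forall>g\<in>carrier G. \<forall>v. T (\<rho> g *v v) = \<rho> g *v T v)"

text \<open>\<open>bs ! i ! k\<close> is the \<open>k\<close>-th basis vector of the \<open>i\<close>-th summand. \<open>matrix_block bs T i j\<close>
  is the block \<open>T\<^sub>i\<^sub>j : V\<^sub>i \<rightarrow> V\<^sub>j\<close>: its \<open>(l, k)\<close> entry is the coordinate of
  \<open>T (bs ! i ! k)\<close> at \<open>bs ! j ! l\<close> with respect to the basis \<open>concat bs\<close>.\<close>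

definition matrix_block ::
    "(('a::field)^'n) list list \<Rightarrow> ('a^'n \<Rightarrow> 'a^'n) \<Rightarrow> nat \<Rightarrow> nat \<Rightarrow> nat \<Rightarrow> nat \<Rightarrow> 'a" where
  "matrix_block bs T i j l k =
     vec.representation (set (concat bs)) (T (bs ! i ! k)) (bs ! j ! l)"

definition symmetry_adapted_basis ::
    "('g, 'b) monoid_scheme \<Rightarrow> ('g \<Rightarrow> ('a::field)^'n^'n) \<Rightarrow> ('a^'n) set list \<Rightarrow> ('a^'n) list \<Rightarrow> bool"
where
  "symmetry_adapted_basis G \<rho> Vs B \<longleftrightarrow>
     (\<exists>bs. B = concat bs \<and> list_all2 ordered_basis_of bs Vs \<and>
       (\<forall>T. equivariant G \<rho> T \<longrightarrow>
         (\<forall>i<length bs. \<forall>j<length bs.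
            (length (bs ! i) = length (bs ! j) \<and>
              (\<exists>c. \<forall>l<length (bs ! j). \<forall>k<length (bs ! i).
                 matrix_block bs T i j l k = (if l = k then c else 0))) \<or>
            (\<forall>l<length (bs ! j). \<forall>k<length (bs ! i). matrix_block bs T i j l k = 0))))"

text \<open>The rows and columns of an \<open>n\<^sub>3 \<times> n\<^sub>3\<close> matrix are indexed by a finite linearly ordered type,
  which fixes their order.\<close>

definition columns_list :: "'a^'n::{finite,linorder}^'r \<Rightarrow> ('a^'r) list" where
  "columns_list A = map (\<lambda>k. column k A) (sorted_list_of_set UNIV)"

definition change_to_symmetry_adapted ::
    "('g, 'b) monoid_scheme \<Rightarrow> ('g \<Rightarrow> complex^'n::{finite,linorder}^'n::{finite,linorder}) \<Rightarrow>
      (complex^'n::{finite,linorder}) set list \<Rightarrow> real^'n::{finite,linorder}^'n::{finite,linorder} \<Rightarrow> bool" where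
  "change_to_symmetry_adapted G \<rho> Vs M \<longleftrightarrow>
     symmetry_adapted_basis G \<rho> Vs (columns_list (map_matrix complex_of_real (matrix_inv M)))"

text \<open>The block diagonal matrix with diagonal blocks \<open>c\<^sub>1 I\<^bsub>d\<^sub>1\<^esub>, \<dots>, c\<^sub>s I\<^bsub>d\<^sub>s\<^esub>\<close>. The number
  \<open>card {..<k}\<close> is the zero-based position of the index \<open>k\<close>.\<close>

definition block_scalar_matrix ::
    "nat list \<Rightarrow> real list \<Rightarrow> real^'n::{finite,linorder}^'n::{finite,linorder}" where
  "block_scalar_matrix ds cs = diag (\<chi> k. concat (map2 replicate ds cs) ! card {..<k})"

definition W_space ::
    "real^'n::{finite,linorder}^'n::{finite,linorder} \<Rightarrow> (complex^'n::{finite,linorder}) set list \<Rightarrow> (real^'n::{finite,linorder}) set" where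
  "W_space M Vs =
     {x. \<exists>cs. length cs = length Vs \<and> diag (M *v x) = block_scalar_matrix (map vec.dim Vs) cs}"

text \<open>The Kronecker product, with rows and columns indexed by pairs.\<close>

definition kronecker ::
    "('a::times)^'m^'m \<Rightarrow> 'a^'n^'n \<Rightarrow> 'a^('m::finite \<times> 'n::finite)^('m \<times> 'n)" where
  "kronecker A B = (\<chi> p q. A $ fst p $ fst q * B $ snd p $ snd q)"

definition invariant_form ::
    "('g, 'b) monoid_scheme \<Rightarrow> ('g \<Rightarrow> real^'n^'n) \<Rightarrow> ('m::finite \<times> 'n::finite) rpoly \<Rightarrow> bool" where
  "invariant_form G \<rho> f \<longleftrightarrow>
     (\<forall>g\<in>carrier G.
        poly_subst (\<lambda>p. (map_matrix Const (kronecker (mat 1 :: real^'m^'m) (\<rho> g)) *v xi) $ p) f = f)"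

end

theory Submission
  imports Defs
begin

text \<open>A Gram tensor \<open>Q\<close> is the same thing as a positive semidefinite Gram matrix \<open>F\<close> of \<open>f\<close>
  all of whose \<open>n\<^sub>3 \<times> n\<^sub>3\<close> blocks have the form \<open>M\<^sup>T diag(d\<^sub>i\<^sub>l) M\<close>, and \<open>f\<close> is invariant
  iff every block of its symmetric Gram matrix commutes with \<open>\<rho>\<close>. A block with \<open>diag(d\<^sub>i\<^sub>l)\<close>
  block scalar acts as a scalar on each summand, hence commutes with \<open>\<rho>\<close>. Conversely, a matrix
  commuting with \<open>\<rho>\<close> has scalar diagonal blocks in the symmetry-adapted basis, and only its
  off-diagonal blocks need multiplicity-freeness. Since \<open>M\<close> is real, the real points of the
  complex summands are irreducible real subrepresentations; in a multiplicity-free representation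
  isomorphic irreducible subrepresentations coincide, so by Schur's lemma a nonzero off-diagonal
  block would make two different summands equal.\<close>

section \<open>Quadratic forms as polynomials\<close>

text \<open>Here \<open>h\<close> acts on coefficients and \<open>\<sigma>\<close> on variables:
  \<open>h = Const\<close> gives substitution, the identity gives the value at a real point. The
  product can range over all variables because an exponent 0 contributes the factor 1.\<close>

definition eval_poly :: "(real \<Rightarrow> 'b::comm_ring_1) \<Rightarrow> ('v::finite \<Rightarrow> 'b) \<Rightarrow> 'v rpoly \<Rightarrow> 'b" where
  "eval_poly h \<sigma> f = (\<Sum>a\<in>Poly_Mapping.keys f. h (Poly_Mapping.lookup f a) *
     (\<Prod>v\<in>UNIV. \<sigma> v ^ Poly_Mapping.lookup a v))"

lemma poly_subst_eq_eval_poly: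
  fixes \<sigma> :: "'v::finite \<Rightarrow> 'w rpoly"
  shows "poly_subst \<sigma> f = eval_poly Const \<sigma> f"
  unfolding poly_subst_def eval_poly_def
proof (intro sum.cong refl arg_cong2[where f="(*)"])
  fix a :: "'v \<Rightarrow>\<^sub>0 nat"
  show "(\<Prod>v\<in>Poly_Mapping.keys a. \<sigma> v ^ Poly_Mapping.lookup a v)
      = (\<Prod>v\<in>UNIV. \<sigma> v ^ Poly_Mapping.lookup a v)"
    by (rule prod.mono_neutral_left) (auto simp: in_keys_iff)
qed

lemma poly_mapping_sum_single:
  "f = (\<Sum>a\<in>Poly_Mapping.keys f. Poly_Mapping.single a (Poly_Mapping.lookup f a))"
  by (rule poly_mapping_eqI) (auto simp: lookup_sum lookup_single when_def in_keys_iff)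

lemma rpoly_induct [case_names zero single add]:
  fixes f :: "('v::finite) rpoly"
  assumes "P 0" "\<And>a c. P (Poly_Mapping.single a c)" "\<And>f g. P f \<Longrightarrow> P g \<Longrightarrow> P (f + g)"
  shows "P f"
proof -
  have "P (\<Sum>a\<in>A. Poly_Mapping.single a (Poly_Mapping.lookup f a))" if "finite A" for A
    using that by (induction A rule: finite_induct) (use assms in auto)
  from this[of "Poly_Mapping.keys f"] show ?thesis
    by (subst poly_mapping_sum_single) simp
qed

text \<open>Instantiated below with \<open>Const\<close>, the identity and
  \<open>complex_of_real\<close>, so that one computation serves polynomial arrays, real tensors and
  complexified matrices.\<close>

locale real_ring_hom =
  fixes h :: "real \<Rightarrow> 'b::comm_ring_1"
  assumes hom_add: "h (x + y) = h x + h y"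
    and hom_mult: "h (x * y) = h x * h y"
    and hom_one: "h 1 = 1"
begin

lemma hom_zero: "h 0 = 0"
  using hom_add[of 0 0] by simp

lemma hom_sum: "h (sum F A) = (\<Sum>x\<in>A. h (F x))"
  by (induction A rule: infinite_finite_induct) (auto simp: hom_zero hom_add)

text \<open>Coefficients off the support contribute \<open>h 0 = 0\<close>. This lets two
  polynomials be summed over one common set of monomials.\<close>

lemma eval_poly_superset:
  assumes "finite A" "Poly_Mapping.keys f \<subseteq> A"
  shows "eval_poly h \<sigma> f = (\<Sum>a\<in>A. h (Poly_Mapping.lookup f a) *
     (\<Prod>v\<in>UNIV. \<sigma> v ^ Poly_Mapping.lookup a v))"
  unfolding eval_poly_def
  by (rule sum.mono_neutral_left) (use assms in \<open>auto simp: in_keys_iff hom_zero\<close>)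

lemma eval_poly_zero: "eval_poly h \<sigma> 0 = 0"
  by (simp add: eval_poly_def)

lemma eval_poly_add: "eval_poly h \<sigma> (f + g) = eval_poly h \<sigma> f + eval_poly h \<sigma> g"
proof -
  let ?A = "Poly_Mapping.keys f \<union> Poly_Mapping.keys g"
  have "Poly_Mapping.keys (f + g) \<subseteq> ?A"
    by (rule Poly_Mapping.keys_add)
  then show ?thesis
    by (simp add: eval_poly_superset[of ?A] lookup_add hom_add algebra_simps sum.distrib)
qed

lemma eval_poly_sum: "eval_poly h \<sigma> (sum F A) = (\<Sum>x\<in>A. eval_poly h \<sigma> (F x))"
  by (induction A rule: infinite_finite_induct) (auto simp: eval_poly_zero eval_poly_add)

lemma eval_poly_single:
  "eval_poly h \<sigma> (Poly_Mapping.single a c) = h c * (\<Prod>v\<in>UNIV. \<sigma> v ^ Poly_Mapping.lookup a v)"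
  by (subst eval_poly_superset[of "{a}"]) auto

lemma eval_poly_mult: "eval_poly h \<sigma> (f * g) = eval_poly h \<sigma> f * eval_poly h \<sigma> g"
proof (induction f rule: rpoly_induct)
  case (single a c)
  show ?case
    by (induction g rule: rpoly_induct)
      (simp_all add: eval_poly_zero eval_poly_add eval_poly_single mult_single lookup_add
        power_add prod.distrib hom_mult algebra_simps)
qed (simp_all add: eval_poly_zero eval_poly_add algebra_simps)

lemma eval_poly_Const: "eval_poly h \<sigma> (Const c) = h c"
  by (simp add: Const_def eval_poly_single)

lemma eval_poly_Var: "eval_poly h \<sigma> (Var v) = \<sigma> v"
proof -
  have "(\<Prod>w\<in>UNIV. \<sigma> w ^ Poly_Mapping.lookup (Poly_Mapping.single v 1) w)
      = (\<Prod>w\<in>UNIV. if w = v then \<sigma> w else 1)"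
    by (rule prod.cong) (auto simp: lookup_single when_def)
  then show ?thesis
    by (simp add: Var_def eval_poly_single hom_one)
qed

end

interpretation Const: real_ring_hom Const
  by unfold_locales (simp_all add: Const_def single_add mult_single)

interpretation id: real_ring_hom "\<lambda>x::real. x"
  by unfold_locales simp_all

section \<open>Quadratic forms and their matrices\<close>

definition quad_poly :: "real^'v^'v \<Rightarrow> ('v::finite) rpoly" where
  "quad_poly F = (\<Sum>p\<in>UNIV. \<Sum>q\<in>UNIV. Const (F $ p $ q) * Var p * Var q)"

lemma (in real_ring_hom) eval_quad_poly:
  "eval_poly h \<sigma> (quad_poly F) = (\<Sum>p\<in>UNIV. \<Sum>q\<in>UNIV. h (F $ p $ q) * \<sigma> p * \<sigma> q)"
  by (simp add: quad_poly_def eval_poly_sum eval_poly_mult eval_poly_Const eval_poly_Var)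

lemma eval_quad_poly_real:
  "eval_poly (\<lambda>x. x) (($) y) (quad_poly F) = y \<bullet> (F *v y)"
  unfolding id.eval_quad_poly inner_vec_def matrix_vector_mult_def
  by (simp add: sum_distrib_left mult_ac)

lemma quad_poly_add: "quad_poly (F + G) = quad_poly F + quad_poly G"
  by (simp add: quad_poly_def Const.hom_add algebra_simps sum.distrib)

lemma quad_poly_zero: "quad_poly 0 = 0"
  by (simp add: quad_poly_def Const.hom_zero)

lemma quad_poly_single_entry:
  "quad_poly (\<chi> r s. if r = p \<and> s = q then c else 0)
    = Poly_Mapping.single (Poly_Mapping.single p 1 + Poly_Mapping.single q 1) c"
proof -
  have "quad_poly (\<chi> r s. if r = p \<and> s = q then c else 0)
    = (\<Sum>r\<in>UNIV. if r = p then \<Sum>s\<in>UNIV. if s = q then Const c * Var p * Var q else 0 else 0)"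
    unfolding quad_poly_def by (intro sum.cong refl) (simp add: Const.hom_zero if_distrib if_distribR cong: if_cong)
  also have "\<dots> = Const c * Var p * Var q"
    by simp
  finally show ?thesis
    by (simp add: Const_def Var_def mult_single)
qed

text \<open>Removing one factor from a monomial of positive degree lowers the degree by one; after
  two removals the degree is 0 and the monomial is trivial. The case \<open>p = q\<close> is
  included.\<close>

lemma degree_two_monomial:
  fixes a :: "('v::finite) \<Rightarrow>\<^sub>0 nat"
  assumes "(\<Sum>v\<in>UNIV. Poly_Mapping.lookup a v) = 2"
  obtains p q where "a = Poly_Mapping.single p 1 + Poly_Mapping.single q 1"
proof -
  have split: "\<exists>p b. a = Poly_Mapping.single p 1 + b \<and> (\<Sum>v\<in>UNIV. Poly_Mapping.lookup b v) = n"
    if "(\<Sum>v\<in>UNIV. Poly_Mapping.lookup a v) = Suc n" for a :: "'v \<Rightarrow>\<^sub>0 nat" and n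
  proof -
    have "\<exists>p. Poly_Mapping.lookup a p \<noteq> 0"
    proof (rule ccontr)
      assume "\<nexists>p. Poly_Mapping.lookup a p \<noteq> 0"
      then show False using that by simp
    qed
    then obtain p where p: "Poly_Mapping.lookup a p \<noteq> 0" by blast
    \<comment> \<open>Subtraction of exponents truncates at 0, which is harmless since the exponent
      of \<open>a\<close> at \<open>p\<close> is positive.\<close>
    define b where "b = a - Poly_Mapping.single p 1"
    have a: "a = Poly_Mapping.single p 1 + b"
      by (rule poly_mapping_eqI)
        (use p in \<open>auto simp: b_def lookup_add lookup_minus lookup_single when_def\<close>)
    have "(\<Sum>v\<in>UNIV. Poly_Mapping.lookup a v) = 1 + (\<Sum>v\<in>UNIV. Poly_Mapping.lookup b v)"
      by (subst a) (simp add: lookup_add lookup_single sum.distrib when_def)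
    with a that show ?thesis by auto
  qed
  obtain p b where pb: "a = Poly_Mapping.single p 1 + b" "(\<Sum>v\<in>UNIV. Poly_Mapping.lookup b v) = 1"
    using split[of a 1] assms by (auto simp: numeral_2_eq_2)
  obtain q b' where qb: "b = Poly_Mapping.single q 1 + b'" "(\<Sum>v\<in>UNIV. Poly_Mapping.lookup b' v) = 0"
    using split[of b 0] pb by auto
  have "b' = 0"
    using qb(2) by (intro poly_mapping_eqI) auto
  with pb qb that show ?thesis by simp
qed

text \<open>The coefficient of each monomial is split equally between the entries
  \<open>(p, q)\<close> and \<open>(q, p)\<close>, which makes the matrix symmetric; for
  \<open>p = q\<close> both halves meet on the diagonal.\<close>

lemma quadratic_form_imp_quad_poly:
  fixes f :: "('v::finite) rpoly"
  assumes "quadratic_form f"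
  obtains F where "transpose F = F" "f = quad_poly F"
proof -
  define P where "P f \<longleftrightarrow> (\<exists>F. transpose F = F \<and> f = quad_poly F)" for f :: "'v rpoly"
  have add: "P (f + g)" if fg: "P f" "P g" for f g
  proof -
    obtain F G where "transpose F = F" "f = quad_poly F" "transpose G = G" "g = quad_poly G"
      using fg by (auto simp: P_def)
    then show ?thesis unfolding P_def
      by (intro exI[of _ "F + G"]) (simp add: quad_poly_add vec_eq_iff transpose_def)
  qed
  \<comment> \<open>The induction runs over subsets of the support of \<open>f\<close>, because the
    degree condition is known only for the monomials of \<open>f\<close>.\<close>
  have "P (\<Sum>a\<in>A. Poly_Mapping.single a (Poly_Mapping.lookup f a))"
    if "finite A" "A \<subseteq> Poly_Mapping.keys f" for A
    using that
  proof (induction A rule: finite_induct)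
    case empty
    have "transpose (0 :: real^'v^'v) = 0" by (simp add: vec_eq_iff transpose_def)
    then show ?case using quad_poly_zero[where 'a='v] by (auto simp: P_def)
  next
    case (insert a A)
    obtain p q where a: "a = Poly_Mapping.single p 1 + Poly_Mapping.single q 1"
      using insert.prems assms degree_two_monomial[of a] by (auto simp: quadratic_form_def)
    define c where "c = Poly_Mapping.lookup f a / 2"
    define E :: "'v \<Rightarrow> 'v \<Rightarrow> real^'v^'v"
      where "E = (\<lambda>p q. \<chi> r s. if r = p \<and> s = q then c else 0)"
    have E_sym: "transpose (E p q + E q p) = E p q + E q p"
      by (simp add: E_def vec_eq_iff transpose_def conj_commute)
    have "Poly_Mapping.single a (Poly_Mapping.lookup f a)
        = Poly_Mapping.single a c + Poly_Mapping.single a c"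
      by (simp add: c_def flip: single_add)
    also have "\<dots> = quad_poly (E p q + E q p)"
      unfolding E_def quad_poly_add quad_poly_single_entry a by (simp add: add.commute)
    finally have "P (Poly_Mapping.single a (Poly_Mapping.lookup f a))"
      using E_sym unfolding P_def by blast
    with insert add show ?case by simp
  qed
  then have "P f"
    using poly_mapping_sum_single[of f] by (metis finite_keys order_refl)
  with that show ?thesis by (auto simp: P_def)
qed

section \<open>Nonnegative forms and sums of squares\<close>

lemma SOS_imp_nonneg:
  assumes "SOS f"
  shows "eval_poly (\<lambda>x. x) y f \<ge> (0::real)"
proof -
  obtain ps where "f = (\<Sum>p\<leftarrow>ps. p ^ 2)"
    using assms by (auto simp: SOS_def)
  moreover have "eval_poly (\<lambda>x. x) y (\<Sum>p\<leftarrow>ps. p ^ 2) \<ge> (0::real)"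
    by (induction ps) (auto simp: id.eval_poly_zero id.eval_poly_add id.eval_poly_mult power2_eq_square)
  ultimately show ?thesis by simp
qed

lemma SOS_add: "SOS f \<Longrightarrow> SOS g \<Longrightarrow> SOS (f + g)"
  unfolding SOS_def by (metis sum_list_append map_append)

lemma SOS_power2: "SOS (p ^ 2)"
  by (auto simp: SOS_def intro!: exI[of _ "[p]"])

lemma SOS_zero: "SOS 0"
  by (auto simp: SOS_def intro!: exI[of _ "[]"])

lemma inner_symmetric:
  fixes F :: "real^'v^'v"
  assumes "transpose F = F"
  shows "x \<bullet> (F *v y) = (F *v x) \<bullet> y"
  using dot_lmul_matrix[of x F y] assms by (metis transpose_matrix_vector)

text \<open>With zero diagonal, the form at \<open>axis p 1 + c *\<^sub>R axis q 1\<close> is linear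
  in \<open>c\<close>, and a linear function without constant term that is never negative vanishes.
  This serves both as the base case of the reduction to squares and as the uniqueness of symmetric
  Gram matrices.\<close>

lemma zero_diagonal_psd_imp_zero:
  fixes F :: "real^'v^'v"
  assumes sym: "transpose F = F" and psd: "\<And>y. 0 \<le> y \<bullet> (F *v y)"
    and diag: "\<And>p. F $ p $ p = 0"
  shows "F = 0"
proof -
  have entry: "F $ p $ q = F $ q $ p" for p q
    using arg_cong[OF sym, of "\<lambda>F. F $ q $ p"] by (simp add: transpose_def)
  have "F $ p $ q = 0" for p q
  proof -
    \<comment> \<open>This value turns the form into minus twice the square of the entry.\<close>
    define t where "t = - F $ p $ q"
    have q: "(axis p 1 + c *\<^sub>R axis q 1) \<bullet> (F *v (axis p 1 + c *\<^sub>R axis q 1))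
      = 2 * c * F $ p $ q" for c
      using diag entry[of q p]
      by (simp add: matrix_vector_right_distrib matrix_vector_mult_scaleR inner_add
          inner_axis_axis inner_axis' matrix_vector_mult_basis column_def)
    from psd[of "axis p 1 + t *\<^sub>R axis q 1"] have "F $ p $ q * F $ p $ q \<le> 0"
      unfolding q by (simp add: t_def)
    then show ?thesis
      by (metis mult_eq_0_iff antisym zero_le_square)
  qed
  then show ?thesis by (simp add: vec_eq_iff)
qed

text \<open>Lagrange's reduction: each step completes a square and clears one more row.\<close>

lemma psd_imp_SOS:
  fixes F :: "real^'v^'v"
  assumes "transpose F = F" and "\<And>y. 0 \<le> y \<bullet> (F *v y)"
  shows "SOS (quad_poly F)"
  using assms
proof (induction "card {p. F $ p \<noteq> 0}" arbitrary: F rule: less_induct)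
  case less
  note sym = inner_symmetric[OF less.prems(1)] and psd = less.prems(2)
  have entry: "F $ p $ q = F $ q $ p" for p q
    using arg_cong[OF less.prems(1), of "\<lambda>F. F $ q $ p"] by (simp add: transpose_def)
  show ?case
  proof (cases "\<forall>p. F $ p $ p = 0")
    case True
    then have "F = 0"
      using zero_diagonal_psd_imp_zero less.prems by blast
    then show ?thesis by (simp add: quad_poly_zero SOS_zero)
  next
    case False
    then obtain r where r: "F $ r $ r \<noteq> 0" by blast
    have "F $ r $ r \<ge> 0"
      using psd[of "axis r 1"] by (simp add: inner_axis' matrix_vector_mult_basis column_def)
    with r have pos: "F $ r $ r > 0" by simp
    define s where "s = sqrt (F $ r $ r)"
    have s: "s * s = F $ r $ r" "s \<noteq> 0" using pos by (auto simp: s_def)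
    \<comment> \<open>\<open>F'\<close> is the Schur complement of the pivot
      \<open>F $ r $ r\<close>, and \<open>S\<close> is the rank-one part that becomes the completed
      square.\<close>
    define F' :: "real^'v^'v" where "F' = (\<chi> p q. F $ p $ q - F $ r $ p * F $ r $ q / F $ r $ r)"
    define S :: "real^'v^'v" where "S = (\<chi> p q. F $ r $ p * F $ r $ q / F $ r $ r)"
    have FS: "F = F' + S" by (simp add: F'_def S_def vec_eq_iff)
    have S_apply: "y \<bullet> (S *v y) = ((F *v y) $ r)\<^sup>2 / F $ r $ r" for y
      by (simp add: S_def inner_vec_def matrix_vector_mult_def power2_eq_square sum_product
          sum_divide_distrib sum_distrib_left mult_ac)
    have "0 \<le> y \<bullet> (F' *v y)" for y
    proof -
      \<comment> \<open>This \<open>t\<close> minimises the form of \<open>F\<close> along the line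
        through \<open>y\<close> in direction \<open>axis r 1\<close>; the minimum is the value of
        \<open>F'\<close> at \<open>y\<close>, so \<open>F'\<close> inherits nonnegativity.\<close>
      define t where "t = (F *v y) $ r / F $ r $ r"
      define z where "z = y - t *\<^sub>R axis r 1"
      have "z \<bullet> (F *v z) = y \<bullet> (F *v y) - 2 * t * (F *v y) $ r + t * t * F $ r $ r"
      proof -
        have "y \<bullet> (F *v axis r 1) = (F *v y) $ r"
          by (simp add: sym inner_axis)
        moreover have "axis r 1 \<bullet> (F *v axis r 1) = F $ r $ r"
          by (simp add: inner_axis' matrix_vector_mult_basis column_def)
        moreover have "axis r 1 \<bullet> (F *v y) = (F *v y) $ r"
          by (simp add: inner_axis')
        ultimately show ?thesis
          by (simp add: z_def matrix_vector_mult_diff_distrib matrix_vector_mult_scaleR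
              inner_diff algebra_simps)
      qed
      also have "\<dots> = y \<bullet> (F *v y) - ((F *v y) $ r)\<^sup>2 / F $ r $ r"
        using r by (simp add: t_def field_simps power2_eq_square)
      also have "\<dots> = y \<bullet> (F' *v y)"
        by (subst FS) (simp add: matrix_vector_mult_add_rdistrib inner_add S_apply)
      finally show ?thesis using psd[of z] by simp
    qed
    moreover have "transpose F' = F'"
      by (simp add: F'_def vec_eq_iff transpose_def entry mult.commute)
    \<comment> \<open>By symmetry a zero row of \<open>F\<close> stays zero in \<open>F'\<close>,
      and row \<open>r\<close> becomes zero, so the measure drops.\<close>
    moreover have "card {p. F' $ p \<noteq> 0} < card {p. F $ p \<noteq> 0}"
    proof (rule psubset_card_mono)
      have "F' $ p = 0" if "F $ p = 0" for p
        using that entry[of r p] by (simp add: F'_def vec_eq_iff)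
      moreover have "F' $ r = 0"
        using r by (simp add: F'_def vec_eq_iff)
      moreover have "F $ r \<noteq> 0" using r by auto
      ultimately show "{p. F' $ p \<noteq> 0} \<subset> {p. F $ p \<noteq> 0}" by auto
    qed simp
    ultimately have "SOS (quad_poly F')"
      using less.hyps by blast
    moreover have "quad_poly S = (\<Sum>p\<in>UNIV. Const (F $ r $ p / s) * Var p)\<^sup>2"
      unfolding quad_poly_def power2_eq_square sum_product
    proof (intro sum.cong refl)
      fix p q
      have "(Const (S $ p $ q) :: 'v rpoly) = Const (F $ r $ p / s) * Const (F $ r $ q / s)"
        using s by (simp add: S_def flip: Const.hom_mult)
      then show "Const (S $ p $ q) * Var p * Var q
        = Const (F $ r $ p / s) * Var p * (Const (F $ r $ q / s) * Var q)"
        by (simp add: mult_ac)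
    qed
    ultimately show ?thesis
      by (subst FS) (simp add: quad_poly_add SOS_add SOS_power2)
  qed
qed

section \<open>Gram matrices and invariance\<close>

text \<open>The adjunction is written with explicit sums because it is applied to vectors of
  polynomials, where no real inner product is at hand.\<close>

lemma inner_matrix_transpose:
  fixes A :: "'a::comm_ring_1^'n^'m"
  shows "(\<Sum>p\<in>UNIV. (A *v x) $ p * y $ p) = (\<Sum>q\<in>UNIV. x $ q * (transpose A *v y) $ q)"
proof -
  have "(\<Sum>p\<in>UNIV. (A *v x) $ p * y $ p) = (\<Sum>p\<in>UNIV. \<Sum>q\<in>UNIV. x $ q * A $ p $ q * y $ p)"
    by (simp add: matrix_vector_mult_def sum_distrib_left mult_ac)
  also have "\<dots> = (\<Sum>q\<in>UNIV. \<Sum>p\<in>UNIV. x $ q * A $ p $ q * y $ p)"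
    by (rule sum.swap)
  finally show ?thesis
    by (simp add: matrix_vector_mult_def transpose_def sum_distrib_left mult_ac)
qed

lemma transpose_map_matrix: "transpose (map_matrix h A) = map_matrix h (transpose A)"
  by (simp add: transpose_def vec_eq_iff)

text \<open>\<open>matrix_inv\<close> is defined by choice; uniqueness of two-sided inverses
  identifies it over any commutative ring, in particular over polynomials.\<close>

lemma matrix_inv_eqI:
  fixes A :: "'a::comm_ring_1^'n^'n"
  assumes "A ** B = mat 1" "B ** A = mat 1"
  shows "matrix_inv A = B"
proof -
  define C where "C = matrix_inv A"
  have "A ** C = mat 1 \<and> C ** A = mat 1"
    unfolding C_def matrix_inv_def by (rule someI[of _ B]) (use assms in simp)
  then have "C ** (A ** B) = B"
    by (simp add: matrix_mul_assoc)
  then show ?thesis using assms by (simp add: C_def)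
qed

section \<open>Tube products as matrices\<close>

context real_ring_hom
begin

lemma map_matrix_mult: "map_matrix h (A ** B) = map_matrix h A ** map_matrix h B"
  by (simp add: matrix_matrix_mult_def vec_eq_iff hom_sum hom_mult)

lemma map_matrix_one: "map_matrix h (mat 1) = mat 1"
  by (simp add: vec_eq_iff mat_def hom_one hom_zero)

lemma map_matrix_diag: "map_matrix h (diag v) = diag (\<chi> k. h (v $ k))"
  by (simp add: vec_eq_iff diag_def hom_zero)

lemma map_matrix_vector_mult: "map_matrix h A *v (\<chi> k. h (v $ k)) = (\<chi> k. h ((A *v v) $ k))"
  by (simp add: vec_eq_iff matrix_vector_mult_def hom_sum hom_mult)

lemma matrix_inv_map_orthogonal:
  assumes "orthogonal_matrix M"
  shows "matrix_inv (map_matrix h M) = map_matrix h (transpose M)"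
  using assms by (intro matrix_inv_eqI)
    (simp_all add: orthogonal_matrix_def map_matrix_one flip: map_matrix_mult)

text \<open>The transpose of \<open>M\<close> remains its inverse after applying \<open>h\<close>,
  so multiplication by a constant tube is a constant matrix, even when the other factor consists of
  polynomials.\<close>

lemma tube_prod_map:
  assumes "orthogonal_matrix M"
  shows "tube_prod (map_matrix h M) (\<chi> k. h (a $ k)) b
    = map_matrix h (transpose M ** diag (M *v a) ** M) *v b"
  by (simp add: tube_prod_def matrix_inv_map_orthogonal[OF assms] map_matrix_vector_mult
      matrix_vector_mul_assoc map_matrix_mult matrix_mul_assoc flip: map_matrix_diag)

end

definition matrix_of_blocks :: "('m \<Rightarrow> 'm \<Rightarrow> 'a^'n^'n) \<Rightarrow> 'a^('m::finite \<times> 'n::finite)^('m \<times> 'n)" where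
  "matrix_of_blocks B = (\<chi> p q. B (fst p) (fst q) $ snd p $ snd q)"

definition block :: "'a^('m::finite \<times> 'n::finite)^('m \<times> 'n) \<Rightarrow> 'm \<Rightarrow> 'm \<Rightarrow> 'a^'n^'n" where
  "block F i l = (\<chi> k k'. F $ (i, k) $ (l, k'))"

lemma block_matrix_of_blocks [simp]: "block (matrix_of_blocks B) i l = B i l"
  by (simp add: block_def matrix_of_blocks_def)

lemma block_eq_iff: "F = H \<longleftrightarrow> (\<forall>i l. block F i l = block H i l)"
  by (auto simp: vec_eq_iff block_def)

lemma transpose_eq_iff_block:
  "transpose F = F \<longleftrightarrow> (\<forall>i l. transpose (block F i l) = block F l i)"
  by (auto simp: vec_eq_iff transpose_def block_def)

text \<open>In the variable order of \<open>xi\<close>, block \<open>(i, l)\<close> is the matrix of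
  multiplication by the tube \<open>Q $ i $ l\<close> when \<open>M\<close> is orthogonal.\<close>

definition gram_matrix :: "real^'n^'n \<Rightarrow> real^'n^'m^'m \<Rightarrow> real^('m::finite \<times> 'n::finite)^('m \<times> 'n)" where
  "gram_matrix M Q = matrix_of_blocks (\<lambda>i l. transpose M ** diag (M *v Q $ i $ l) ** M)"

lemma sum_UNIV_pair: "(\<Sum>p\<in>UNIV. f p) = (\<Sum>i\<in>UNIV. \<Sum>k\<in>UNIV. f (i, k))"
  unfolding UNIV_Times_UNIV[symmetric] by (simp only: sum.cartesian_product case_prod_eta)

text \<open>Used twice: with \<open>Const\<close> it computes the polynomial of \<open>Q\<close>,
  with the identity it computes the real form in the definition of \<open>PSD\<close>.\<close>

lemma (in real_ring_hom) tensor_inner_gram: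
  assumes "orthogonal_matrix M"
  shows "tensor_inner (fold_tensor x) (tensor_prod (map_matrix h M) (map_tensor h Q) (fold_tensor x))
    = (\<Sum>p\<in>UNIV. \<Sum>q\<in>UNIV. h (gram_matrix M Q $ p $ q) * x $ p * x $ q)"
proof -
  have tube: "map_tensor h Q $ i $ l = (\<chi> k. h (Q $ i $ l $ k))" for i l
    by (simp add: map_tensor_def)
  show ?thesis
    by (simp add: tensor_inner_def tensor_prod_def tube tube_prod_map[OF assms] UNIV_1
        sum_UNIV_pair gram_matrix_def matrix_of_blocks_def)
      (simp add: fold_tensor_def matrix_vector_mult_def sum_distrib_left mult_ac)
qed

lemma gram_tensor_iff:
  fixes Q :: "real^'n^'m^'m"
  assumes "orthogonal_matrix M"
  shows "gram_tensor M f Q \<longleftrightarrow> symmetric_tensor Q \<and>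
    (\<forall>y. 0 \<le> y \<bullet> (gram_matrix M Q *v y)) \<and> f = quad_poly (gram_matrix M Q)"
proof -
  have "tensor_inner (fold_tensor y) (tensor_prod M Q (fold_tensor y)) = y \<bullet> (gram_matrix M Q *v y)"
    for y
    using id.tensor_inner_gram[OF assms, of y Q]
    by (simp add: map_matrix_def map_tensor_def inner_vec_def matrix_vector_mult_def
        sum_distrib_left mult_ac)
  \<comment> \<open>Folding is onto, so quantifying over tensors \<open>Y\<close> amounts to
    quantifying over vectors \<open>y\<close>.\<close>
  moreover have "\<exists>y. Y = fold_tensor y" for Y :: "real^'n^1^'m"
    by (intro exI[of _ "\<chi> p. Y $ fst p $ 1 $ snd p"]) (simp add: fold_tensor_def vec_eq_iff)
  ultimately have psd: "(\<forall>Y :: real^'n^1^'m. 0 \<le> tensor_inner Y (tensor_prod M Q Y)) \<longleftrightarrow>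
      (\<forall>y. 0 \<le> y \<bullet> (gram_matrix M Q *v y))"
    by metis
  show ?thesis
    unfolding gram_tensor_def PSD_def mem_Collect_eq psd Const.tensor_inner_gram[OF assms]
    by (simp add: quad_poly_def xi_def)
qed

lemma symmetric_tensor_iff: "symmetric_tensor Q \<longleftrightarrow> (\<forall>i l. Q $ i $ l = Q $ l $ i)"
  by (auto simp: symmetric_tensor_def frontal_slice_def transpose_def vec_eq_iff)

lemma transpose_diag: "transpose (diag v) = diag v"
  by (simp add: diag_def transpose_def vec_eq_iff)

text \<open>Every block is itself symmetric, being a diagonal matrix conjugated by \<open>M\<close>;
  transposing therefore only exchanges \<open>(i, l)\<close> and \<open>(l, i)\<close>.\<close>

lemma gram_matrix_symmetric:
  assumes "symmetric_tensor Q"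
  shows "transpose (gram_matrix M Q) = gram_matrix M Q"
  using assms by (auto simp: transpose_eq_iff_block gram_matrix_def symmetric_tensor_iff
      matrix_transpose_mul transpose_diag matrix_mul_assoc)

section \<open>Invariance as commutation of blocks\<close>

text \<open>The difference of the two matrices has an identically zero form, hence zero diagonal and
  no negative values, so the zero-diagonal lemma applies.\<close>

lemma quad_poly_inject:
  assumes "transpose F = F" "transpose H = H" "quad_poly F = quad_poly H"
  shows "F = H"
proof -
  have form: "y \<bullet> ((F - H) *v y) = 0" for y
    using assms(3) by (simp add: matrix_vector_mult_diff_rdistrib inner_diff flip: eval_quad_poly_real)
  have "F - H = 0"
  proof (rule zero_diagonal_psd_imp_zero)
    show "transpose (F - H) = F - H"
      using assms by (simp add: vec_eq_iff transpose_def)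
    show "(F - H) $ p $ p = 0" for p
      using form[of "axis p 1"] by (simp add: inner_axis' matrix_vector_mult_basis column_def)
  qed (simp add: form)
  then show ?thesis by simp
qed

lemma poly_subst_quad_poly:
  fixes F R :: "real^'v^'v"
  shows "poly_subst (\<lambda>p. (map_matrix Const R *v (\<chi> q. Var q)) $ p) (quad_poly F)
    = quad_poly (transpose R ** F ** R)"
proof -
  have *: "(\<Sum>p\<in>UNIV. \<Sum>q\<in>UNIV. Const (F $ p $ q) * x $ p * x $ q)
    = (\<Sum>p\<in>UNIV. x $ p * (map_matrix Const F *v x) $ p)" for F :: "real^'v^'v" and x :: "'v rpoly^'v"
    by (simp add: matrix_vector_mult_def sum_distrib_left mult_ac)
  have q: "quad_poly F = (\<Sum>p\<in>UNIV. Var p * (map_matrix Const F *v (\<chi> q. Var q)) $ p)"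
    for F :: "real^'v^'v"
    using *[of F "\<chi> q. Var q"] by (simp add: quad_poly_def)
  show ?thesis
    unfolding poly_subst_eq_eval_poly Const.eval_quad_poly * inner_matrix_transpose
    by (simp add: q matrix_vector_mul_assoc transpose_map_matrix matrix_mul_assoc Const.map_matrix_mult)
qed

lemma block_mult_kronecker:
  fixes A :: "real^'n^'n" and F :: "real^('m::finite \<times> 'n::finite)^('m \<times> 'n)"
  shows "block (F ** kronecker (mat 1) A) i l = block F i l ** A"
    and "block (kronecker (mat 1) A ** F) i l = A ** block F i l"
proof -
  have 1: "(\<Sum>a\<in>UNIV. \<Sum>c\<in>UNIV. F $ (i, k) $ (a, c) * ((if a = l then 1 else 0) * A $ c $ k'))
     = (\<Sum>a\<in>UNIV. if a = l then \<Sum>c\<in>UNIV. F $ (i, k) $ (l, c) * A $ c $ k' else 0)" for k k'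
    by (intro sum.cong refl) auto
  have 2: "(\<Sum>a\<in>UNIV. \<Sum>c\<in>UNIV. (if i = a then 1 else 0) * A $ k $ c * F $ (a, c) $ (l, k'))
     = (\<Sum>a\<in>UNIV. if i = a then \<Sum>c\<in>UNIV. A $ k $ c * F $ (i, c) $ (l, k') else 0)" for k k'
    by (intro sum.cong refl) auto
  show "block (F ** kronecker (mat 1) A) i l = block F i l ** A"
    and "block (kronecker (mat 1) A ** F) i l = A ** block F i l"
    unfolding vec_eq_iff block_def kronecker_def matrix_matrix_mult_def mat_def
    by (simp_all add: sum_UNIV_pair 1 2)
qed

lemma transpose_kronecker: "transpose (kronecker (mat 1) A) = kronecker (mat 1) (transpose A)"
  by (auto simp: vec_eq_iff transpose_def kronecker_def mat_def)

text \<open>Substitution replaces \<open>F\<close> by \<open>transpose R ** F ** R\<close>, which is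
  again symmetric, so equality of polynomials is equality of matrices. Comparing blocks and
  cancelling the orthogonal \<open>\<rho> g\<close> turns this into commutation.\<close>

lemma invariant_quad_poly_iff:
  fixes F :: "real^('m::finite \<times> 'n::finite)^('m \<times> 'n)"
  assumes sym: "transpose F = F" and orth: "\<forall>g\<in>carrier G. orthogonal_matrix (\<rho> g)"
  shows "invariant_form G \<rho> (quad_poly F) \<longleftrightarrow>
    (\<forall>g\<in>carrier G. \<forall>i l. \<rho> g ** block F i l = block F i l ** \<rho> g)"
proof -
  have "quad_poly (transpose R ** F ** R) = quad_poly F \<longleftrightarrow>
      (\<forall>i l. \<rho> g ** block F i l = block F i l ** \<rho> g)"
    if g: "g \<in> carrier G" and R: "R = kronecker (mat 1) (\<rho> g)" for g R
  proof -
    have "transpose (transpose R ** F ** R) = transpose R ** F ** R"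
      by (simp add: matrix_transpose_mul sym matrix_mul_assoc)
    then have "quad_poly (transpose R ** F ** R) = quad_poly F \<longleftrightarrow> transpose R ** F ** R = F"
      using sym quad_poly_inject by metis
    also have "\<dots> \<longleftrightarrow> (\<forall>i l. transpose (\<rho> g) ** block F i l ** \<rho> g = block F i l)"
      unfolding block_eq_iff R by (simp add: transpose_kronecker block_mult_kronecker)
    also have "\<dots> \<longleftrightarrow> (\<forall>i l. \<rho> g ** block F i l = block F i l ** \<rho> g)"
    proof -
      have "transpose (\<rho> g) ** \<rho> g = mat 1" "\<rho> g ** transpose (\<rho> g) = mat 1"
        using orth g by (auto simp: orthogonal_matrix_def)
      then have "transpose (\<rho> g) ** B ** \<rho> g = B \<longleftrightarrow> \<rho> g ** B = B ** \<rho> g" for B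
        by (metis matrix_mul_assoc matrix_mul_lid)
      then show ?thesis by simp
    qed
    finally show ?thesis .
  qed
  then show ?thesis
    by (simp add: invariant_form_def xi_def poly_subst_quad_poly)
qed

section \<open>Irreducible subrepresentations\<close>

lemma subrep_mult: "subrep G \<rho> V \<Longrightarrow> g \<in> carrier G \<Longrightarrow> v \<in> V \<Longrightarrow> \<rho> g *v v \<in> V"
  by (auto simp: subrep_def)

text \<open>The kernel of \<open>T\<close> in \<open>U\<close> is a proper subrepresentation, hence
  zero, and the image is a nonzero subrepresentation of \<open>V\<close>, hence all of
  \<open>V\<close>.\<close>

lemma schur:
  fixes \<rho> :: "'g \<Rightarrow> ('a::field)^'n^'n"
  assumes U: "irreducible_subrep G \<rho> U" and V: "irreducible_subrep G \<rho> V"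
    and T: "Vector_Spaces.linear (*s) (*s) T" and TU: "T ` U \<subseteq> V"
    and eq: "\<And>g u. g \<in> carrier G \<Longrightarrow> u \<in> U \<Longrightarrow> T (\<rho> g *v u) = \<rho> g *v T u"
    and u: "u \<in> U" "T u \<noteq> 0"
  shows "isomorphic_subreps G \<rho> U V"
proof -
  interpret T: Vector_Spaces.linear "(*s)" "(*s)" T by fact
  have subU: "vec.subspace U" "subrep G \<rho> U"
    using U by (auto simp: irreducible_subrep_def subrep_def)
  have "subrep G \<rho> {u \<in> U. T u = 0}"
    using subU eq by (auto simp: subrep_def vec.subspace_def T.add T.scale)
  then have "{u \<in> U. T u = 0} = {0}"
    using U u unfolding irreducible_subrep_def by blast
  then have ker: "v = 0" if "v \<in> U" "T v = 0" for v
    using that by blast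
  have inj: "inj_on T U"
  proof (rule inj_onI)
    fix x y assume "x \<in> U" "y \<in> U" "T x = T y"
    then show "x = y"
      using ker[of "x - y"] subU(1) by (simp add: T.diff vec.subspace_diff)
  qed
  have "subrep G \<rho> (T ` U)"
    unfolding subrep_def
  proof (intro conjI ballI)
    show "vec.subspace (T ` U)"
      using subU(1) by (rule T.subspace_image)
    show "\<rho> g *v v \<in> T ` U" if "g \<in> carrier G" "v \<in> T ` U" for g v
    proof -
      obtain u where u: "u \<in> U" "v = T u" using \<open>v \<in> T ` U\<close> by blast
      have "T (\<rho> g *v u) \<in> T ` U"
        using subrep_mult[OF subU(2) \<open>g \<in> carrier G\<close> u(1)] by (rule imageI)
      then show ?thesis using eq[OF \<open>g \<in> carrier G\<close> u(1)] u(2) by simp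
    qed
  qed
  moreover have "T ` U \<noteq> {0}" using u by auto
  ultimately have "T ` U = V"
    using V TU unfolding irreducible_subrep_def by blast
  with inj T eq show ?thesis
    unfolding isomorphic_subreps_def bij_betw_def by (intro exI[of _ T]) simp
qed

lemma isomorphic_subreps_refl: "isomorphic_subreps G \<rho> U U"
  unfolding isomorphic_subreps_def
  by (intro exI[of _ id]) (auto simp: vec.linear_id)

text \<open>The inverse on \<open>V\<close> has to come from a globally defined linear map; a linear
  left inverse of \<open>T\<close> on \<open>U\<close> provides one.\<close>

lemma isomorphic_subreps_sym:
  assumes "subrep G \<rho> U" and "isomorphic_subreps G \<rho> U V"
  shows "isomorphic_subreps G \<rho> V U"
proof -
  obtain T where T: "Vector_Spaces.linear (*s) (*s) T" "bij_betw T U V"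
    "\<And>g u. g \<in> carrier G \<Longrightarrow> u \<in> U \<Longrightarrow> T (\<rho> g *v u) = \<rho> g *v T u"
    using assms(2) by (auto simp: isomorphic_subreps_def)
  obtain S where S: "Vector_Spaces.linear (*s) (*s) S" "\<And>v. v \<in> U \<Longrightarrow> S (T v) = v"
    using vec.linear_exists_left_inverse_on[OF T(1), of U] T(2) assms(1)
    by (auto simp: bij_betw_def subrep_def)
  have V: "V = T ` U" using T(2) by (simp add: bij_betw_def)
  have "bij_betw S V U"
    by (rule bij_betw_byWitness[of _ T]) (auto simp: V S)
  moreover have "S (\<rho> g *v v) = \<rho> g *v S v" if "g \<in> carrier G" "v \<in> V" for g v
    using that subrep_mult[OF assms(1)] by (auto simp: V S simp flip: T(3))
  ultimately show ?thesis
    using S(1) unfolding isomorphic_subreps_def by blast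
qed

lemma isomorphic_subreps_trans:
  assumes "isomorphic_subreps G \<rho> U V" and "isomorphic_subreps G \<rho> V W"
  shows "isomorphic_subreps G \<rho> U W"
proof -
  obtain T where T: "Vector_Spaces.linear (*s) (*s) T" "bij_betw T U V"
    "\<And>g u. g \<in> carrier G \<Longrightarrow> u \<in> U \<Longrightarrow> T (\<rho> g *v u) = \<rho> g *v T u"
    using assms(1) by (auto simp: isomorphic_subreps_def)
  obtain S where S: "Vector_Spaces.linear (*s) (*s) S" "bij_betw S V W"
    "\<And>g u. g \<in> carrier G \<Longrightarrow> u \<in> V \<Longrightarrow> S (\<rho> g *v u) = \<rho> g *v S u"
    using assms(2) by (auto simp: isomorphic_subreps_def)
  have "Vector_Spaces.linear (*s) (*s) (S \<circ> T)" "bij_betw (S \<circ> T) U W"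
    using Vector_Spaces.linear_compose[OF T(1) S(1)] bij_betw_trans[OF T(2) S(2)] by auto
  moreover have "(S \<circ> T) (\<rho> g *v u) = \<rho> g *v (S \<circ> T) u" if "g \<in> carrier G" "u \<in> U" for g u
    using that T S(3) bij_betwE[OF T(2)] by simp
  ultimately show ?thesis
    unfolding isomorphic_subreps_def by blast
qed

section \<open>Decompositions and multiplicity one\<close>

text \<open>Components in a direct sum are unique, so any decomposition of a vector into members of
  the summands gives its projections. Linearity and equivariance follow by exhibiting such
  decompositions.\<close>

lemma irrep_decomposition_projections:
  fixes \<rho> :: "'g \<Rightarrow> ('a::field)^'n^'n"
  assumes "irrep_decomposition G \<rho> Us"
  obtains \<pi> :: "nat \<Rightarrow> 'a^'n \<Rightarrow> 'a^'n" where
    "\<And>i. i < length Us \<Longrightarrow> Vector_Spaces.linear (*s) (*s) (\<pi> i)"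
    "\<And>i x. i < length Us \<Longrightarrow> \<pi> i x \<in> Us ! i"
    "\<And>x. (\<Sum>i<length Us. \<pi> i x) = x"
    "\<And>i g x. i < length Us \<Longrightarrow> g \<in> carrier G \<Longrightarrow> \<pi> i (\<rho> g *v x) = \<rho> g *v \<pi> i x"
proof -
  define S where "S = (\<Pi>\<^sub>E i\<in>{..<length Us}. Us ! i)"
  define \<phi> :: "(nat \<Rightarrow> 'a^'n) \<Rightarrow> 'a^'n" where "\<phi> = (\<lambda>u. \<Sum>i<length Us. u i)"
  have bij: "bij_betw \<phi> S UNIV"
    using assms by (simp add: irrep_decomposition_def S_def \<phi>_def)
  have sub: "subrep G \<rho> (Us ! i)" "vec.subspace (Us ! i)" if "i < length Us" for i
    using assms that by (auto simp: irrep_decomposition_def irreducible_subrep_def subrep_def)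
  define \<pi> where "\<pi> = (\<lambda>i x. inv_into S \<phi> x i)"
  have mem: "\<pi> i x \<in> Us ! i" if "i < length Us" for i x
  proof -
    have "inv_into S \<phi> x \<in> S"
      using bij by (intro inv_into_into) (simp add: bij_betw_def)
    then show ?thesis using that by (auto simp: S_def \<pi>_def)
  qed
  have sum: "(\<Sum>i<length Us. \<pi> i x) = x" for x
    using bij_betw_inv_into_right[OF bij, of x] by (simp add: \<phi>_def \<pi>_def)
  have unique: "\<pi> i x = u i"
    if "i < length Us" "\<And>j. j < length Us \<Longrightarrow> u j \<in> Us ! j" "x = (\<Sum>j<length Us. u j)" for i x u
  proof -
    \<comment> \<open>Restriction makes \<open>u\<close> extensional, as membership in the dependent
      product requires.\<close>
    have "restrict u {..<length Us} \<in> S" "\<phi> (restrict u {..<length Us}) = x"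
      using that by (auto simp: S_def \<phi>_def)
    then have "inv_into S \<phi> x = restrict u {..<length Us}"
      using bij_betw_inv_into_left[OF bij] by blast
    then show ?thesis using that(1) by (simp add: \<pi>_def)
  qed
  show ?thesis
  proof (rule that[of \<pi>])
    show "Vector_Spaces.linear (*s) (*s) (\<pi> i)" if i: "i < length Us" for i
      unfolding Vector_Spaces.linear_iff
    proof (intro conjI allI vec.vector_space_axioms)
      fix x y :: "'a^'n" and c :: 'a
      show "\<pi> i (x + y) = \<pi> i x + \<pi> i y"
        by (rule unique[OF i]) (auto simp: sum.distrib sum intro!: vec.subspace_add sub mem)
      show "\<pi> i (c *s x) = c *s \<pi> i x"
        by (rule unique[OF i])
          (auto simp: sum intro!: vec.subspace_scale sub mem simp flip: vec.scale_sum_right)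
    qed
    show "\<pi> i (\<rho> g *v x) = \<rho> g *v \<pi> i x" if i: "i < length Us" "g \<in> carrier G" for i g x
    proof (rule unique[OF i(1)])
      show "\<rho> g *v x = (\<Sum>j<length Us. \<rho> g *v \<pi> j x)"
        by (simp add: sum flip: vec.sum)
    qed (auto intro!: subrep_mult[OF sub(1) i(2)] mem)
  qed (fact mem sum)+
qed

text \<open>By Schur's lemma a projection that is nonzero on \<open>W\<close> makes \<open>W\<close>
  isomorphic to that summand. Multiplicity one allows only one such summand, so \<open>W\<close>
  lies inside it and, by irreducibility, is that very subspace.\<close>

lemma irreducible_mem_decomposition:
  fixes \<rho> :: "'g \<Rightarrow> ('a::field)^'n^'n"
  assumes dec: "irrep_decomposition G \<rho> Us"
    and mult: "\<And>U. U \<in> set Us \<Longrightarrow> multiplicity_in G \<rho> Us U \<le> 1"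
    and W: "irreducible_subrep G \<rho> W"
  obtains k where "k < length Us" "W = Us ! k"
    "\<And>j. j < length Us \<Longrightarrow> isomorphic_subreps G \<rho> W (Us ! j) \<Longrightarrow> j = k"
proof -
  obtain \<pi> :: "nat \<Rightarrow> 'a^'n \<Rightarrow> 'a^'n" where \<pi>:
    "\<And>i. i < length Us \<Longrightarrow> Vector_Spaces.linear (*s) (*s) (\<pi> i)"
    "\<And>i x. i < length Us \<Longrightarrow> \<pi> i x \<in> Us ! i"
    "\<And>x. (\<Sum>i<length Us. \<pi> i x) = x"
    "\<And>i g x. i < length Us \<Longrightarrow> g \<in> carrier G \<Longrightarrow> \<pi> i (\<rho> g *v x) = \<rho> g *v \<pi> i x"
    by (rule irrep_decomposition_projections[OF dec], rule that)
  have irr: "irreducible_subrep G \<rho> (Us ! i)" if "i < length Us" for i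
    using dec that by (simp add: irrep_decomposition_def)
  have sub: "subrep G \<rho> W" using W by (simp add: irreducible_subrep_def)
  \<comment> \<open>Each summand already counts itself, so a second isomorphic index would give
    multiplicity two.\<close>
  have unique: "i = j" if "i < length Us" "j < length Us" "isomorphic_subreps G \<rho> (Us ! i) (Us ! j)" for i j
    using mult[of "Us ! i"] that isomorphic_subreps_refl[of G \<rho> "Us ! i"]
    by (auto simp: multiplicity_in_def card_le_Suc0_iff_eq)
  have iso: "isomorphic_subreps G \<rho> W (Us ! i)" if "i < length Us" "x \<in> W" "\<pi> i x \<noteq> 0" for i x
    using that \<pi> by (intro schur[OF W irr, of i "\<pi> i" x]) auto
  have "0 \<in> W"
    using sub by (auto simp: subrep_def vec.subspace_0)
  then obtain w where w: "w \<in> W" "w \<noteq> 0"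
    using W unfolding irreducible_subrep_def by blast
  have "\<exists>k<length Us. \<pi> k w \<noteq> 0"
    using \<pi>(3)[of w] w(2) by (metis lessThan_iff sum.neutral)
  then obtain k where k: "k < length Us" "\<pi> k w \<noteq> 0" by blast
  have eq: "j = k" if "j < length Us" "isomorphic_subreps G \<rho> W (Us ! j)" for j
    using unique[OF k(1) that(1) isomorphic_subreps_trans[OF isomorphic_subreps_sym[OF sub] that(2)]]
      iso[OF k(1) w(1) k(2)] by simp
  have "W \<subseteq> Us ! k"
  proof
    fix x assume x: "x \<in> W"
    have "(\<Sum>i<length Us. \<pi> i x) = (\<Sum>i<length Us. if i = k then \<pi> k x else 0)"
    proof (intro sum.cong refl)
      show "\<pi> i x = (if i = k then \<pi> k x else 0)" if "i \<in> {..<length Us}" for i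
      proof (cases "\<pi> i x = 0")
        case False
        then have "i = k" using that eq[of i] iso[of i x] x by blast
        then show ?thesis by simp
      qed (use eq in auto)
    qed
    also have "\<dots> = \<pi> k x" using k by simp
    finally show "x \<in> Us ! k" using \<pi>(2,3) k(1) by metis
  qed
  then have "W = Us ! k"
    using irr[OF k(1)] W unfolding irreducible_subrep_def by blast
  with k(1) eq that show ?thesis by blast
qed

text \<open>Both subspaces are summands of the chosen decomposition, and only one index carries a
  summand isomorphic to \<open>V\<close>.\<close>

lemma multiplicity_free_isomorphic_imp_eq:
  fixes \<rho> :: "'g \<Rightarrow> ('a::field)^'n^'n"
  assumes "multiplicity_free G \<rho>" "irreducible_subrep G \<rho> V" "irreducible_subrep G \<rho> W"
    and "isomorphic_subreps G \<rho> V W"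
  shows "V = W"
proof -
  obtain Us where Us: "irrep_decomposition G \<rho> Us" "\<And>U. U \<in> set Us \<Longrightarrow> multiplicity_in G \<rho> Us U \<le> 1"
    using assms(1) by (auto simp: multiplicity_free_def)
  obtain j where "j < length Us" "W = Us ! j"
    using irreducible_mem_decomposition[OF Us assms(3)] by metis
  moreover obtain i where "i < length Us" "V = Us ! i"
    "\<And>j. j < length Us \<Longrightarrow> isomorphic_subreps G \<rho> V (Us ! j) \<Longrightarrow> j = i"
    using irreducible_mem_decomposition[OF Us assms(2)] by metis
  ultimately show ?thesis using assms(4) by blast
qed

section \<open>Symmetry-adapted bases over the reals\<close>

definition cvec :: "real^'n \<Rightarrow> complex^'n" where
  "cvec v = (\<chi> k. complex_of_real (v $ k))"

definition real_points :: "(complex^'n) set \<Rightarrow> (real^'n) set" where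
  "real_points V = {v. cvec v \<in> V}"

interpretation of_real: real_ring_hom complex_of_real
  by unfold_locales simp_all

lemma complexify_cvec: "complexify \<rho> g *v cvec v = cvec (\<rho> g *v v)"
  by (simp add: complexify_def cvec_def of_real.map_matrix_vector_mult)

lemma cvec_eq_iff: "cvec v = cvec w \<longleftrightarrow> v = w"
  by (simp add: cvec_def vec_eq_iff)

definition Re_vec :: "complex^'n \<Rightarrow> real^'n" where "Re_vec x = (\<chi> k. Re (x $ k))"
definition Im_vec :: "complex^'n \<Rightarrow> real^'n" where "Im_vec x = (\<chi> k. Im (x $ k))"

lemma Re_vec_add: "Re_vec (x + y) = Re_vec x + Re_vec y"
  and Im_vec_add: "Im_vec (x + y) = Im_vec x + Im_vec y"
  and Re_vec_scale: "Re_vec (c *s x) = Re c *s Re_vec x - Im c *s Im_vec x"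
  and Im_vec_scale: "Im_vec (c *s x) = Re c *s Im_vec x + Im c *s Re_vec x"
  and Re_vec_cvec: "Re_vec (cvec v) = v"
  and Im_vec_cvec: "Im_vec (cvec v) = 0"
  and Re_vec_zero: "Re_vec 0 = 0"
  and Im_vec_zero: "Im_vec 0 = 0"
  and cvec_decompose: "x = cvec (Re_vec x) + \<i> *s cvec (Im_vec x)"
  by (simp_all add: Re_vec_def Im_vec_def cvec_def vec_eq_iff complex_eq)

lemma Re_vec_complexify: "Re_vec (complexify \<rho> g *v x) = \<rho> g *v Re_vec x"
  and Im_vec_complexify: "Im_vec (complexify \<rho> g *v x) = \<rho> g *v Im_vec x"
  by (simp_all add: Re_vec_def Im_vec_def complexify_def vec_eq_iff matrix_vector_mult_def)

lemma cvec_add: "cvec (v + w) = cvec v + cvec w"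
  and cvec_scale: "cvec (c *s v) = complex_of_real c *s cvec v"
  and cvec_zero: "cvec 0 = 0"
  by (simp_all add: cvec_def vec_eq_iff)

lemma subspace_real_points:
  assumes "vec.subspace V"
  shows "vec.subspace (real_points V)"
  using assms by (simp add: vec.subspace_def real_points_def cvec_add cvec_scale cvec_zero)

text \<open>A real subrepresentation of the real points complexifies to a complex subrepresentation
  of \<open>V\<close>, which must be zero or everything. The vector \<open>r\<close> ensures that
  the real points are not trivial.\<close>

lemma irreducible_real_points:
  fixes \<rho> :: "'g \<Rightarrow> real^'n^'n"
  assumes V: "irreducible_subrep G (complexify \<rho>) V"
    and r: "r \<in> real_points V" "r \<noteq> 0"
  shows "irreducible_subrep G \<rho> (real_points V)"
proof -
  have sub: "subrep G (complexify \<rho>) V" "vec.subspace V"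
    using V by (auto simp: irreducible_subrep_def subrep_def)
  have "subrep G \<rho> (real_points V)"
    using sub(2) subspace_real_points subrep_mult[OF sub(1)]
    by (auto simp: subrep_def real_points_def simp flip: complexify_cvec)
  moreover have "real_points V \<noteq> {0}" using r by blast
  moreover have "U = {0} \<or> U = real_points V" if U: "subrep G \<rho> U" "U \<subseteq> real_points V" for U
  proof -
    \<comment> \<open>The complexification of \<open>U\<close>; its real points are exactly
      \<open>U\<close>.\<close>
    define C where "C = {x. Re_vec x \<in> U \<and> Im_vec x \<in> U}"
    have subU: "vec.subspace U" using U(1) by (simp add: subrep_def)
    have cvec_C: "cvec u \<in> C \<longleftrightarrow> u \<in> U" for u
      using subU by (simp add: C_def Re_vec_cvec Im_vec_cvec vec.subspace_0)
    have "subrep G (complexify \<rho>) C"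
      unfolding subrep_def
    proof
      show "vec.subspace C"
        using subU unfolding vec.subspace_def[of C]
        by (simp add: C_def Re_vec_zero Im_vec_zero Re_vec_add Im_vec_add Re_vec_scale Im_vec_scale
            vec.subspace_0 vec.subspace_add vec.subspace_diff vec.subspace_scale)
    qed (use subrep_mult[OF U(1)] in \<open>simp add: C_def Re_vec_complexify Im_vec_complexify\<close>)
    moreover have "C \<subseteq> V"
    proof
      fix x assume "x \<in> C"
      then have "cvec (Re_vec x) \<in> V" "cvec (Im_vec x) \<in> V"
        using U(2) by (auto simp: C_def real_points_def)
      then show "x \<in> V"
        using sub(2) cvec_decompose[of x] by (metis vec.subspace_add vec.subspace_scale)
    qed
    ultimately consider "C = {0}" | "C = V"
      using V unfolding irreducible_subrep_def by blast
    then show ?thesis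
    proof cases
      case 1
      then have "u = 0" if "u \<in> U" for u
        using that cvec_C[of u] cvec_eq_iff[of u 0] by (simp add: cvec_zero)
      then show ?thesis using vec.subspace_0[OF subU] by blast
    next
      case 2
      then show ?thesis using cvec_C by (auto simp: real_points_def)
    qed
  qed
  ultimately show ?thesis unfolding irreducible_subrep_def by blast
qed

section \<open>Positions in an ordered basis split into blocks\<close>

lemma sorted_list_of_set_nth_card_less:
  fixes k :: "'a::{finite,linorder}"
  shows "sorted_list_of_set UNIV ! card {..<k} = k"
    and "card {..<k} < length (sorted_list_of_set (UNIV :: 'a set))"
proof -
  define xs where "xs = sorted_list_of_set (UNIV :: 'a set)"
  have xs: "sorted_wrt (<) xs" "set xs = UNIV" "distinct xs"
    by (simp_all add: xs_def strict_sorted_list_of_set)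
  obtain p where p: "p < length xs" "xs ! p = k"
    using xs(2) by (metis UNIV_I in_set_conv_nth)
  have "{..<k} = (!) xs ` {..<p}"
  proof (intro subset_antisym subsetI)
    fix x assume "x \<in> {..<k}"
    moreover obtain q where q: "q < length xs" "xs ! q = x"
      using xs(2) by (metis UNIV_I in_set_conv_nth)
    ultimately have "\<not> p \<le> q"
      using sorted_wrt_nth_less[OF xs(1), of p q] p by (auto simp: le_less)
    with q show "x \<in> (!) xs ` {..<p}" by auto
  qed (use sorted_wrt_nth_less[OF xs(1)] p in auto)
  then have "card {..<k} = p"
    using xs(3) p(1) by (simp add: card_image inj_on_nth)
  with p show "sorted_list_of_set UNIV ! card {..<k} = k"
    and "card {..<k} < length (sorted_list_of_set (UNIV :: 'a set))"
    by (simp_all add: xs_def)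
qed

text \<open>One index \<open>i\<close>, independent of \<open>cs\<close>, serves both lists: the
  replicated scalars have the same block lengths as \<open>bs\<close>, so position \<open>p\<close>
  falls into the same block.\<close>

lemma concat_nth_block:
  fixes bs :: "'a list list"
  assumes "p < length (concat bs)"
  shows "\<exists>i<length bs. concat bs ! p \<in> set (bs ! i) \<and>
    (\<forall>cs :: 'c list. length cs = length bs \<longrightarrow> concat (map2 replicate (map length bs) cs) ! p = cs ! i)"
  using assms
proof (induction bs arbitrary: p)
  case (Cons b bs)
  show ?case
  proof (cases "p < length b")
    case True
    then show ?thesis
      by (intro exI[of _ 0]) (auto simp: nth_append length_Suc_conv)
  next
    case False
    then have "p - length b < length (concat bs)" using Cons.prems by simp
    then obtain i where "i < length bs" "concat bs ! (p - length b) \<in> set (bs ! i)"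
      "\<And>cs :: 'c list. length cs = length bs \<Longrightarrow> concat (map2 replicate (map length bs) cs) ! (p - length b) = cs ! i"
      using Cons.IH[OF \<open>p - length b < length (concat bs)\<close>] by auto
    then show ?thesis using False
      by (intro exI[of _ "Suc i"]) (auto simp: nth_append length_Suc_conv)
  qed
qed simp

lemma distinct_concat_block_unique:
  assumes "distinct (concat bs)" "i < length bs" "j < length bs" "x \<in> set (bs ! i)" "x \<in> set (bs ! j)"
  shows "i = j"
  using assms
proof (induction bs arbitrary: i j)
  case (Cons b bs)
  have "x \<notin> set b \<or> x \<notin> set (bs ! k)" if "k < length bs" for k
    using Cons.prems(1) nth_mem[OF that] by auto
  with Cons show ?case
    by (cases i; cases j) auto
qed simp

section \<open>Coordinates with respect to the rows of an orthogonal matrix\<close>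

lemma row_inner_row_orthogonal:
  fixes M :: "real^'n^'n"
  assumes "orthogonal_matrix M"
  shows "row k M \<bullet> row k' M = (if k = k' then 1 else 0)"
proof -
  have "(M ** transpose M) $ k $ k' = mat 1 $ k $ k'"
    using assms by (simp add: orthogonal_matrix_def)
  then show ?thesis
    by (simp add: matrix_matrix_mult_def transpose_def row_def inner_vec_def mat_def)
qed

lemma cvec_row_inject:
  fixes M :: "real^'n^'n"
  assumes "orthogonal_matrix M"
  shows "cvec (row k' M) = cvec (row k M) \<longleftrightarrow> k' = k"
  using row_inner_row_orthogonal[OF assms, of k k'] row_inner_row_orthogonal[OF assms, of k k]
  by (auto simp: cvec_eq_iff split: if_splits)

lemma row_expansion_orthogonal:
  fixes M :: "real^'n^'n"
  assumes "orthogonal_matrix M"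
  shows "y = (\<Sum>k\<in>UNIV. (row k M \<bullet> y) *s row k M)"
proof -
  have "(\<Sum>k\<in>UNIV. (row k M \<bullet> y) *s row k M) = transpose M *v (M *v y)"
    by (simp add: vec_eq_iff matrix_vector_mult_def transpose_def row_def inner_vec_def mult.commute)
  then show ?thesis
    using assms by (simp add: matrix_vector_mul_assoc orthogonal_matrix_def)
qed

text \<open>For orthogonal \<open>M\<close> the rows are the columns of the inverse, that is, the
  new basis, so these are the entries of \<open>A\<close> in that basis.\<close>

lemma conjugate_entry:
  fixes M :: "real^'n^'n"
  shows "(M ** A ** transpose M) $ k' $ k = row k' M \<bullet> (A *v row k M)"
proof -
  have "(M ** A ** transpose M) $ k' $ k = (M *v (A *v (transpose M *v axis k 1))) $ k'"
    unfolding matrix_vector_mul_assoc matrix_mul_assoc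
    by (simp add: matrix_vector_mult_basis column_def)
  moreover have "transpose M *v axis k 1 = row k M"
    by (simp add: matrix_vector_mult_basis column_transpose)
  moreover have "(M *v z) $ k' = row k' M \<bullet> z" for z
    by (simp add: matrix_vector_mult_def row_def inner_vec_def)
  ultimately show ?thesis by metis
qed

lemma cvec_rows_basis:
  fixes M :: "real^'n^'n"
  assumes M: "orthogonal_matrix M"
  shows "vec.independent (range (\<lambda>k. cvec (row k M)))"
    and "vec.span (range (\<lambda>k. cvec (row k M))) = UNIV"
proof -
  let ?B = "range (\<lambda>k. cvec (row k M))"
  have mem: "cvec y \<in> vec.span ?B" for y
  proof -
    have "cvec y = (\<Sum>k\<in>UNIV. complex_of_real (row k M \<bullet> y) *s cvec (row k M))"
      by (subst row_expansion_orthogonal[OF M, of y]) (simp add: cvec_def vec_eq_iff)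
    also have "\<dots> \<in> vec.span ?B"
      by (intro vec.span_sum vec.span_scale vec.span_base) auto
    finally show ?thesis .
  qed
  have "x \<in> vec.span ?B" for x
    by (subst cvec_decompose) (intro vec.span_add vec.span_scale mem)
  then show span: "vec.span ?B = UNIV" by blast
  \<comment> \<open>A spanning set with no more elements than the dimension is independent.\<close>
  show "vec.independent ?B"
  proof (rule vec.card_le_dim_spanning[of _ UNIV])
    show "card ?B \<le> vec.dim (UNIV :: (complex^'n) set)"
      unfolding vec_dim_card by (rule card_image_le) simp
  qed (use span in auto)
qed

text \<open>The real orthonormal expansion of \<open>y\<close> is also its complex expansion, so
  complex coordinates of real vectors are real inner products.\<close>

lemma representation_cvec_rows:
  fixes M :: "real^'n^'n"
  assumes M: "orthogonal_matrix M"
  shows "vec.representation (range (\<lambda>k. cvec (row k M))) (cvec y) (cvec (row k' M))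
    = complex_of_real (row k' M \<bullet> y)"
proof -
  let ?B = "range (\<lambda>k. cvec (row k M))"
  note B = cvec_rows_basis[OF M]
  have "cvec y = (\<Sum>k\<in>UNIV. complex_of_real (row k M \<bullet> y) *s cvec (row k M))"
    by (subst row_expansion_orthogonal[OF M, of y]) (simp add: cvec_def vec_eq_iff)
  then show ?thesis
    by (simp add: vec.representation_sum[OF B(1)] vec.representation_scale[OF B(1)] B(2)
        vec.representation_basis[OF B(1)] cvec_row_inject[OF M] if_distrib cong: if_cong)
qed

text \<open>Translates the complex basis into real data: \<open>blk k\<close> is the index of the
  summand containing row \<open>k\<close> of \<open>M\<close>. Of the block condition on equivariant
  maps only the diagonal blocks are kept.\<close>

lemma adapted_basis_blocks:
  fixes \<rho> :: "'g \<Rightarrow> real^'n::{finite,linorder}^'n::{finite,linorder}"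
  assumes M: "orthogonal_matrix M" and adapted: "change_to_symmetry_adapted G (complexify \<rho>) Vs M"
  obtains blk where "\<And>k. blk k < length Vs"
    and "\<And>(cs :: real list) k. length cs = length Vs \<Longrightarrow>
      concat (map2 replicate (map vec.dim Vs) cs) ! card {..<k} = cs ! blk k"
    and "\<And>k. row k M \<in> real_points (Vs ! blk k)"
    and "\<And>i k x. i < length Vs \<Longrightarrow> x \<in> real_points (Vs ! i) \<Longrightarrow> blk k \<noteq> i \<Longrightarrow> row k M \<bullet> x = 0"
    and "\<And>T i. (\<And>g. g \<in> carrier G \<Longrightarrow> \<rho> g ** T = T ** \<rho> g) \<Longrightarrow>
      \<exists>c. \<forall>k k'. blk k = i \<longrightarrow> blk k' = i \<longrightarrow> row k' M \<bullet> (T *v row k M) = (if k = k' then c else 0)"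
proof -
  have "matrix_inv M = transpose M"
    using M by (intro matrix_inv_eqI) (simp_all add: orthogonal_matrix_def)
  then have cols: "columns_list (map_matrix complex_of_real (matrix_inv M))
      = map (\<lambda>k. cvec (row k M)) (sorted_list_of_set UNIV)"
    by (simp add: columns_list_def cvec_def column_def row_def transpose_def)
  obtain bs where bs: "concat bs = map (\<lambda>k. cvec (row k M)) (sorted_list_of_set UNIV)"
    "list_all2 ordered_basis_of bs Vs"
    "\<And>T i j. equivariant G (complexify \<rho>) T \<Longrightarrow> i < length bs \<Longrightarrow> j < length bs \<Longrightarrow>
       (length (bs ! i) = length (bs ! j) \<and>
              (\<exists>c. \<forall>l<length (bs ! j). \<forall>k<length (bs ! i).
                 matrix_block bs T i j l k = (if l = k then c else 0))) \<or>
            (\<forall>l<length (bs ! j). \<forall>k<length (bs ! i). matrix_block bs T i j l k = 0)"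
    using adapted unfolding change_to_symmetry_adapted_def symmetry_adapted_basis_def cols
    by (metis (no_types, lifting))
  have len: "length bs = length Vs" using bs(2) by (rule list_all2_lengthD)
  have basis: "distinct (bs ! i)" "vec.independent (set (bs ! i))" "vec.span (set (bs ! i)) = Vs ! i"
    if "i < length Vs" for i
    using bs(2) that len by (auto simp: list_all2_conv_all_nth ordered_basis_of_def)
  \<comment> \<open>The block sizes in \<open>W_space\<close> are dimensions, those of
    \<open>bs\<close> are lengths; they agree because each list is a basis.\<close>
  have dims: "map vec.dim Vs = map length bs"
  proof (rule nth_equalityI)
    fix i assume "i < length (map vec.dim Vs)"
    then show "map vec.dim Vs ! i = map length bs ! i"
      using basis[of i] len vec.dim_span_eq_card_independent[of "set (bs ! i)"]
      by (simp add: distinct_card)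
  qed (simp add: len)
  have set_concat: "set (concat bs) = range (\<lambda>k. cvec (row k M))"
    unfolding bs(1) by simp
  have distinct: "distinct (concat bs)"
    unfolding bs(1) by (simp add: distinct_map inj_on_def cvec_row_inject[OF M])
  have "\<exists>i<length bs. cvec (row k M) \<in> set (bs ! i) \<and> (\<forall>cs :: real list. length cs = length bs \<longrightarrow>
      concat (map2 replicate (map length bs) cs) ! card {..<k} = cs ! i)" for k
  proof -
    have "card {..<k} < length (concat bs)" "concat bs ! card {..<k} = cvec (row k M)"
      using sorted_list_of_set_nth_card_less[of k] unfolding bs(1) by simp_all
    then show ?thesis using concat_nth_block[of "card {..<k}" bs] by simp
  qed
  then obtain blk where blk: "\<And>k. blk k < length bs" "\<And>k. cvec (row k M) \<in> set (bs ! blk k)"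
    "\<And>k (cs :: real list). length cs = length bs \<Longrightarrow>
      concat (map2 replicate (map length bs) cs) ! card {..<k} = cs ! blk k"
    by metis
  show ?thesis
  proof (rule that[of blk])
    show "blk k < length Vs" for k using blk(1) len by simp
    show "concat (map2 replicate (map vec.dim Vs) cs) ! card {..<k} = cs ! blk k"
      if "length cs = length Vs" for cs :: "real list" and k
      unfolding dims using that len by (simp add: blk(3))
    show "row k M \<in> real_points (Vs ! blk k)" for k
      using basis(3)[of "blk k"] blk(1,2)[of k] len vec.span_base by (force simp: real_points_def)
    show "row k M \<bullet> x = 0" if i: "i < length Vs" "x \<in> real_points (Vs ! i)" "blk k \<noteq> i" for i k x
    proof -
      \<comment> \<open>The annihilator of row \<open>k\<close> under the bilinear pairing. It is a
        complex subspace, so containing a basis of summand \<open>i\<close> it contains the whole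
        summand.\<close>
      define N where "N = {z. (\<Sum>j\<in>UNIV. complex_of_real (row k M $ j) * z $ j) = 0}"
      have cvec_N: "cvec y \<in> N \<longleftrightarrow> row k M \<bullet> y = 0" for y
        by (simp add: N_def cvec_def inner_vec_def flip: of_real_mult of_real_sum)
      have "vec.subspace N"
        by (auto simp: vec.subspace_def N_def algebra_simps sum.distrib simp flip: sum_distrib_left)
      moreover have "set (bs ! i) \<subseteq> N"
      proof
        fix b assume b: "b \<in> set (bs ! i)"
        then have "b \<in> set (concat bs)" using i(1) len by auto
        then obtain k' where k': "b = cvec (row k' M)" unfolding set_concat by blast
        have "k' \<noteq> k"
          using distinct_concat_block_unique[OF distinct, of "blk k" i b] blk(1,2)[of k] b i len k' by auto
        then show "b \<in> N"
          using row_inner_row_orthogonal[OF M, of k k'] by (simp add: k' cvec_N)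
      qed
      ultimately have "Vs ! i \<subseteq> N"
        using basis(3)[OF i(1)] vec.span_minimal by metis
      then show ?thesis using i(2) cvec_N by (auto simp: real_points_def)
    qed
    show "\<exists>c. \<forall>k k'. blk k = i \<longrightarrow> blk k' = i \<longrightarrow> row k' M \<bullet> (T *v row k M) = (if k = k' then c else 0)"
      if T: "\<And>g. g \<in> carrier G \<Longrightarrow> \<rho> g ** T = T ** \<rho> g" for T i
    proof (cases "i < length bs")
      case True
      define T' where "T' = map_matrix complex_of_real T"
      have "equivariant G (complexify \<rho>) ((*v) T')"
        using T by (simp add: equivariant_def T'_def complexify_def matrix_vector_mul_assoc
            flip: of_real.map_matrix_mult)
      \<comment> \<open>For a diagonal block both alternatives are scalar; a zero block has
        \<open>c = 0\<close>.\<close>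
      from bs(3)[OF this True True] obtain c where c:
        "\<And>l k. l < length (bs ! i) \<Longrightarrow> k < length (bs ! i) \<Longrightarrow>
          matrix_block bs ((*v) T') i i l k = (if l = k then c else 0)"
        by (metis (full_types))
      have "complex_of_real (row k' M \<bullet> (T *v row k M)) = (if k = k' then c else 0)"
        if k: "blk k = i" "blk k' = i" for k k'
      proof -
        obtain p where p: "p < length (bs ! i)" "bs ! i ! p = cvec (row k M)"
          using blk(2)[of k] k(1) by (auto simp: in_set_conv_nth)
        obtain q where q: "q < length (bs ! i)" "bs ! i ! q = cvec (row k' M)"
          using blk(2)[of k'] k(2) by (auto simp: in_set_conv_nth)
        have pq: "q = p \<longleftrightarrow> k = k'"
          using p q cvec_row_inject[OF M] nth_eq_iff_index_eq[of "bs ! i" q p] basis(1)[of i] True len by metis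
        have "T' *v cvec (row k M) = cvec (T *v row k M)"
          by (simp add: T'_def cvec_def of_real.map_matrix_vector_mult)
        then have "matrix_block bs ((*v) T') i i q p = complex_of_real (row k' M \<bullet> (T *v row k M))"
          unfolding matrix_block_def set_concat p(2) q(2) by (simp add: representation_cvec_rows[OF M])
        then show ?thesis using c[OF q(1) p(1)] pq by simp
      qed
      \<comment> \<open>The scalar \<open>c\<close> is complex, but the entries are real, so its
        real part can replace it.\<close>
      then have "row k' M \<bullet> (T *v row k M) = (if k = k' then Re c else 0)"
        if "blk k = i" "blk k' = i" for k k'
        using that by (metis Re_complex_of_real zero_complex.simps(1))
      then show ?thesis by blast
    next
      case False
      then show ?thesis using blk(1) by auto
    qed
  qed
qed

section \<open>The commutant in a symmetry-adapted basis\<close>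

lemma diag_inject: "diag v = diag w \<longleftrightarrow> v = w"
  by (auto simp: diag_def vec_eq_iff)

lemma matrix_mult_diag: "(A ** diag v) $ i $ j = A $ i $ j * (v :: real^'n) $ j"
  and diag_mult_matrix: "(diag v ** A) $ i $ j = v $ i * A $ i $ j"
  and diag_vector_mult: "(diag v *v x) $ i = v $ i * x $ i"
  by (simp_all add: matrix_matrix_mult_def matrix_vector_mult_def diag_def if_distrib if_distribR cong: if_cong)

lemma orthogonal_cancel:
  assumes "orthogonal_matrix M"
  shows "transpose M ** M = mat 1" "M ** transpose M = mat 1"
    and "A ** transpose M ** M = A" "A ** M ** transpose M = A"
proof -
  show *: "transpose M ** M = mat 1" "M ** transpose M = mat 1"
    using assms by (simp_all add: orthogonal_matrix_def)
  show "A ** transpose M ** M = A" "A ** M ** transpose M = A"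
    by (simp_all add: * flip: matrix_mul_assoc)
qed

text \<open>In the basis of rows, a matrix commutes with \<open>diag v\<close> once its entries
  vanish wherever the two diagonal values differ.\<close>

lemma conjugate_diag_commute:
  fixes A M :: "real^'n^'n"
  assumes M: "orthogonal_matrix M"
    and zero: "\<And>k k'. v $ k \<noteq> v $ k' \<Longrightarrow> row k' M \<bullet> (A *v row k M) = 0"
  shows "A ** (transpose M ** diag v ** M) = transpose M ** diag v ** M ** A"
proof -
  define R where "R = M ** A ** transpose M"
  have "R ** diag v = diag v ** R"
    using zero by (auto simp: vec_eq_iff matrix_mult_diag diag_mult_matrix R_def conjugate_entry)
  then have "transpose M ** (R ** diag v) ** M = transpose M ** (diag v ** R) ** M"
    by simp
  then show ?thesis
    by (simp add: R_def matrix_mul_assoc orthogonal_cancel[OF M])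
qed

section \<open>Matrices commuting with the representation\<close>

locale adapted_blocks =
  fixes G :: "('g, 'b) monoid_scheme"
    and \<rho> :: "'g \<Rightarrow> real^'n::{finite,linorder}^'n::{finite,linorder}"
    and Vs :: "(complex^'n::{finite,linorder}) set list"
    and M :: "real^'n::{finite,linorder}^'n::{finite,linorder}"
    and blk :: "'n \<Rightarrow> nat"
  assumes orth: "orthogonal_matrix M"
    and irreducible: "i < length Vs \<Longrightarrow> irreducible_subrep G (complexify \<rho>) (Vs ! i)"
    and blk_less: "blk k < length Vs"
    and blk_entry: "length (cs :: real list) = length Vs \<Longrightarrow>
      concat (map2 replicate (map vec.dim Vs) cs) ! card {..<k} = cs ! blk k"
    and row_mem: "row k M \<in> real_points (Vs ! blk k)"
    and row_orthogonal: "i < length Vs \<Longrightarrow> x \<in> real_points (Vs ! i) \<Longrightarrow> blk k \<noteq> i \<Longrightarrow> row k M \<bullet> x = 0"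
    and scalar_block: "(\<And>g. g \<in> carrier G \<Longrightarrow> \<rho> g ** T = T ** \<rho> g) \<Longrightarrow>
      \<exists>c. \<forall>k k'. blk k = i \<longrightarrow> blk k' = i \<longrightarrow> row k' M \<bullet> (T *v row k M) = (if k = k' then c else 0)"
begin

lemma W_space_iff: "x \<in> W_space M Vs \<longleftrightarrow> (\<exists>cs. length cs = length Vs \<and> M *v x = (\<chi> k. cs ! blk k))"
  by (simp add: W_space_def block_scalar_matrix_def diag_inject blk_entry cong: conj_cong)

lemma real_points_irreducible: "irreducible_subrep G \<rho> (real_points (Vs ! blk k))"
proof (rule irreducible_real_points[OF irreducible[OF blk_less] row_mem])
  show "row k M \<noteq> 0"
    using row_inner_row_orthogonal[OF orth, of k k] by auto
qed

text \<open>\<open>\<rho> g\<close> keeps row \<open>k\<close> inside its summand, which is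
  orthogonal to the rows of all other summands; only entries between equal values of
  \<open>v\<close> survive.\<close>

lemma block_scalar_commutes:
  assumes "g \<in> carrier G" and "\<And>k k'. blk k = blk k' \<Longrightarrow> v $ k = v $ k'"
  shows "\<rho> g ** (transpose M ** diag v ** M) = transpose M ** diag v ** M ** \<rho> g"
proof (rule conjugate_diag_commute[OF orth])
  fix k k' assume "v $ k \<noteq> v $ k'"
  with assms(2) have "blk k' \<noteq> blk k" by metis
  moreover have "\<rho> g *v row k M \<in> real_points (Vs ! blk k)"
    using real_points_irreducible[of k] row_mem assms(1)
    by (auto simp: irreducible_subrep_def intro: subrep_mult)
  ultimately show "row k' M \<bullet> (\<rho> g *v row k M) = 0"
    using row_orthogonal[OF blk_less] by blast
qed

text \<open>A nonzero entry would make \<open>F\<close>, followed by the projection \<open>P\<close>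
  onto the summand of \<open>k'\<close>, a nonzero equivariant map between two irreducible real
  summands. Multiplicity-freeness then forces these to coincide, although they are
  orthogonal.\<close>

lemma off_diagonal_block_zero:
  assumes free: "multiplicity_free G \<rho>"
    and F: "\<And>g. g \<in> carrier G \<Longrightarrow> \<rho> g ** F = F ** \<rho> g" and blk: "blk k \<noteq> blk k'"
  shows "row k' M \<bullet> (F *v row k M) = 0"
proof (rule ccontr)
  assume nz: "row k' M \<bullet> (F *v row k M) \<noteq> 0"
  \<comment> \<open>The indicator of the block of \<open>k'\<close>; it is constant on blocks, so
    the resulting orthogonal projection \<open>P\<close> commutes with the representation.\<close>
  define e where "e = (\<chi> k. if blk k = blk k' then 1 else (0::real))"
  define P where "P = transpose M ** diag e ** M"
  have P_comm: "\<rho> g ** P = P ** \<rho> g" if "g \<in> carrier G" for g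
    unfolding P_def using that by (rule block_scalar_commutes) (simp add: e_def)
  have P_mem: "P *v y \<in> real_points (Vs ! blk k')" for y
  proof -
    have sub: "vec.subspace (real_points (Vs ! blk k'))"
      using real_points_irreducible[of k'] by (simp add: irreducible_subrep_def subrep_def)
    have "P *v y = transpose M *v (diag e *v (M *v y))"
      by (simp add: P_def matrix_vector_mul_assoc matrix_mul_assoc)
    also have "\<dots> = (\<Sum>k\<in>UNIV. (e $ k * (M *v y) $ k) *s row k M)"
      unfolding matrix_vector_mult_def[of "transpose M"]
      by (simp add: vec_eq_iff diag_vector_mult transpose_def row_def mult_ac)
    also have "\<dots> \<in> real_points (Vs ! blk k')"
    proof (rule vec.subspace_sum[OF sub])
      show "(e $ k * (M *v y) $ k) *s row k M \<in> real_points (Vs ! blk k')" for k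
        using row_mem[of k] vec.subspace_scale[OF sub] vec.subspace_0[OF sub]
        by (cases "blk k = blk k'") (auto simp: e_def)
    qed
    finally show ?thesis .
  qed
  have P_row: "row k' M \<bullet> (P *v y) = row k' M \<bullet> y" for y
  proof -
    have *: "row k' M \<bullet> z = (M *v z) $ k'" for z
      by (simp add: matrix_vector_mult_def row_def inner_vec_def)
    have "M *v (P *v y) = diag e *v (M *v y)"
      by (simp add: P_def matrix_vector_mul_assoc matrix_mul_assoc orthogonal_cancel[OF orth])
    then show ?thesis
      unfolding * by (simp add: diag_vector_mult e_def)
  qed
  have "isomorphic_subreps G \<rho> (real_points (Vs ! blk k)) (real_points (Vs ! blk k'))"
  proof (rule schur[OF real_points_irreducible real_points_irreducible, of "(*v) (P ** F)"])
    show "(*v) (P ** F) ` real_points (Vs ! blk k) \<subseteq> real_points (Vs ! blk k')"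
      by (auto simp: P_mem simp flip: matrix_vector_mul_assoc)
    show "(P ** F) *v (\<rho> g *v u) = \<rho> g *v ((P ** F) *v u)" if g: "g \<in> carrier G" for g u
    proof -
      have "(P ** F) ** \<rho> g = \<rho> g ** (P ** F)"
        using F[OF g] P_comm[OF g] by (metis matrix_mul_assoc)
      then show ?thesis by (simp add: matrix_vector_mul_assoc)
    qed
    show "(P ** F) *v row k M \<noteq> 0"
      using nz P_row[of "F *v row k M"] by (auto simp: matrix_vector_mul_assoc)
  qed (simp_all add: row_mem)
  then have "real_points (Vs ! blk k) = real_points (Vs ! blk k')"
    using multiplicity_free_isomorphic_imp_eq[OF free] real_points_irreducible by blast
  then have "row k M \<bullet> row k M = 0"
    using row_orthogonal[OF blk_less _ blk] row_mem[of k] by blast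
  then show False
    using row_inner_row_orthogonal[OF orth, of k k] by simp
qed

lemma commutant_block_scalar:
  assumes "multiplicity_free G \<rho>" and F: "\<And>g. g \<in> carrier G \<Longrightarrow> \<rho> g ** F = F ** \<rho> g"
  shows "\<exists>c. M ** F ** transpose M = diag (\<chi> k. c (blk k))"
proof -
  have "\<exists>c. \<forall>i k k'. blk k = i \<longrightarrow> blk k' = i \<longrightarrow>
      row k' M \<bullet> (F *v row k M) = (if k = k' then c i else 0)"
    by (intro choice allI scalar_block F)
  then obtain c where c: "\<And>i k k'. blk k = i \<Longrightarrow> blk k' = i \<Longrightarrow>
      row k' M \<bullet> (F *v row k M) = (if k = k' then c i else 0)"
    by blast
  have "(M ** F ** transpose M) $ k' $ k = diag (\<chi> k. c (blk k)) $ k' $ k" for k k'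
  proof (cases "blk k = blk k'")
    case True
    show ?thesis
      using c[OF True refl] unfolding conjugate_entry diag_def vec_lambda_beta
      by (cases "k = k'") auto
  next
    case False
    then have "k' \<noteq> k" by blast
    then show ?thesis
      unfolding conjugate_entry using off_diagonal_block_zero[OF assms False] by (simp add: diag_def)
  qed
  then have "M ** F ** transpose M = diag (\<chi> k. c (blk k))" by (simp add: vec_eq_iff)
  then show ?thesis by blast
qed

end

theorem theorem5p2:
  fixes G :: "('g, 'b) monoid_scheme"
    and \<rho> :: "'g \<Rightarrow> real^'n::{finite,linorder}^'n::{finite,linorder}"
    and Vs :: "(complex^'n::{finite,linorder}) set list"
    and M :: "real^'n::{finite,linorder}^'n::{finite,linorder}"
    and f :: "('m::finite \<times> 'n::{finite,linorder}) rpoly"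
  assumes "group G" and "finite (carrier G)"
    and "\<rho> \<in> hom G GL"
    and "\<forall>g\<in>carrier G. orthogonal_matrix (\<rho> g)"
    and "totally_real G (complexify \<rho>)"
    and "irrep_decomposition G (complexify \<rho>) Vs"
    and "orthogonal_matrix M"
    and "change_to_symmetry_adapted G (complexify \<rho>) Vs M"
    and "quadratic_form f"
  shows "(M_SOS M f \<and> (\<exists>Q. gram_tensor M f Q \<and> (\<forall>i j. Q $ i $ j \<in> W_space M Vs))
            \<longrightarrow> SOS f \<and> invariant_form G \<rho> f) \<and>
         (multiplicity_free G \<rho> \<longrightarrow> SOS f \<and> invariant_form G \<rho> f
            \<longrightarrow> M_SOS M f \<and> (\<exists>Q. gram_tensor M f Q \<and> (\<forall>i j. Q $ i $ j \<in> W_space M Vs)))"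
proof -
  note orth = assms(7) and \<rho>_orth = assms(4)
  have "\<exists>blk. adapted_blocks G \<rho> Vs M blk"
  proof (rule adapted_basis_blocks[OF assms(7,8)])
    fix blk :: "'n \<Rightarrow> nat"
    assume "\<And>k. blk k < length Vs"
      and "\<And>(cs :: real list) k. length cs = length Vs \<Longrightarrow>
        concat (map2 replicate (map vec.dim Vs) cs) ! card {..<k} = cs ! blk k"
      and "\<And>k. row k M \<in> real_points (Vs ! blk k)"
      and "\<And>i k x. i < length Vs \<Longrightarrow> x \<in> real_points (Vs ! i) \<Longrightarrow> blk k \<noteq> i \<Longrightarrow> row k M \<bullet> x = 0"
      and "\<And>T i. (\<And>g. g \<in> carrier G \<Longrightarrow> \<rho> g ** T = T ** \<rho> g) \<Longrightarrow>
        \<exists>c. \<forall>k k'. blk k = i \<longrightarrow> blk k' = i \<longrightarrow> row k' M \<bullet> (T *v row k M) = (if k = k' then c else 0)"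
    then have "adapted_blocks G \<rho> Vs M blk"
      using assms(6,7) by (intro adapted_blocks.intro) (simp_all add: irrep_decomposition_def)
    then show "\<exists>blk. adapted_blocks G \<rho> Vs M blk" by (intro exI[of _ blk])
  qed
  then obtain blk where "adapted_blocks G \<rho> Vs M blk" ..
  then interpret adapted_blocks G \<rho> Vs M blk .
  show ?thesis
  proof (intro conjI impI)
    assume "M_SOS M f \<and> (\<exists>Q. gram_tensor M f Q \<and> (\<forall>i j. Q $ i $ j \<in> W_space M Vs))"
    then obtain Q where Q: "gram_tensor M f Q" "\<And>i j. Q $ i $ j \<in> W_space M Vs" by blast
    define F where "F = gram_matrix M Q"
    have F: "transpose F = F" "\<And>y. 0 \<le> y \<bullet> (F *v y)" "f = quad_poly F"
      using Q(1) gram_matrix_symmetric unfolding gram_tensor_iff[OF orth] F_def by auto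
    show "SOS f" unfolding F(3) by (rule psd_imp_SOS[OF F(1,2)])
    \<comment> \<open>Tubes in \<open>W_space\<close> have transforms constant on each summand, so
      every block commutes.\<close>
    have "\<rho> g ** block F i l = block F i l ** \<rho> g" if "g \<in> carrier G" for g i l
      using that Q(2)[of i l] unfolding F_def gram_matrix_def block_matrix_of_blocks W_space_iff
      by (auto intro!: block_scalar_commutes)
    then show "invariant_form G \<rho> f"
      unfolding F(3) invariant_quad_poly_iff[OF F(1) \<rho>_orth] by blast
  next
    assume free: "multiplicity_free G \<rho>" and f: "SOS f \<and> invariant_form G \<rho> f"
    obtain F where F: "transpose F = F" "f = quad_poly F"
      using quadratic_form_imp_quad_poly[OF assms(9)] .
    have "\<exists>c. M ** block F i l ** transpose M = diag (\<chi> k. c (blk k))" for i l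
      using f unfolding F(2) invariant_quad_poly_iff[OF F(1) \<rho>_orth]
      by (intro commutant_block_scalar[OF free]) blast
    then obtain c where c: "\<And>i l. M ** block F i l ** transpose M = diag (\<chi> k. c i l (blk k))"
      by metis
    \<comment> \<open>The inverse transform of the scalars: \<open>M\<close> sends tube
      \<open>(i, l)\<close> to the diagonal of the conjugated block of \<open>F\<close>, so the Gram
      matrix of \<open>Q\<close> is \<open>F\<close>.\<close>
    define Q :: "real^'n::{finite,linorder}^'m^'m" where "Q = (\<chi> i l. transpose M *v (\<chi> k. c i l (blk k)))"
    have MQ: "M *v Q $ i $ l = (\<chi> k. c i l (blk k))" for i l
      by (simp add: Q_def matrix_vector_mul_assoc orthogonal_cancel[OF orth] del: transpose_matrix_vector)
    have "block (gram_matrix M Q) i l = block F i l" for i l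
      by (simp add: gram_matrix_def MQ matrix_mul_assoc orthogonal_cancel[OF orth] flip: c)
    then have gram: "gram_matrix M Q = F" by (simp add: block_eq_iff)
    have "Q $ i $ l = Q $ l $ i" for i l
    proof -
      \<comment> \<open>Transposing block \<open>(i, l)\<close> of the symmetric \<open>F\<close>
        gives block \<open>(l, i)\<close>, while diagonal matrices are their own transposes; hence
        the scalars agree.\<close>
      have "diag (\<chi> k. c l i (blk k)) = transpose (diag (\<chi> k. c i l (blk k)))"
        using F(1) unfolding transpose_eq_iff_block
        by (simp add: matrix_transpose_mul matrix_mul_assoc flip: c)
      then show ?thesis by (simp add: Q_def transpose_diag diag_inject)
    qed
    \<comment> \<open>A sum of squares takes nonnegative values, and its value at \<open>y\<close>
      is the form of \<open>F\<close>.\<close>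
    moreover have "0 \<le> y \<bullet> (F *v y)" for y
      using SOS_imp_nonneg[of f "($) y"] f by (simp add: F(2) eval_quad_poly_real)
    ultimately have "gram_tensor M f Q"
      unfolding gram_tensor_iff[OF orth] gram symmetric_tensor_iff using F(2) by blast
    \<comment> \<open>The witness lists one scalar per summand; \<open>blk_less\<close> keeps the
      lookup in range.\<close>
    moreover have "Q $ i $ l \<in> W_space M Vs" for i l
      unfolding W_space_iff MQ
      by (intro exI[of _ "map (c i l) [0..<length Vs]"]) (simp add: blk_less vec_eq_iff)
    ultimately show "M_SOS M f" and "\<exists>Q. gram_tensor M f Q \<and> (\<forall>i j. Q $ i $ j \<in> W_space M Vs)"
      by (auto simp: M_SOS_def)
  qed
qed

end
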